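(* Let $A$ be a twisted generalized Weyl construction or a twisted generalized Weyl algebra with data $(R,\boldsymbol{\sigma},\boldsymbol{t},\boldsymbol{\mu})$, let $M$ be a simple weight $A$-module with no proper inner breaks and let $\mathfrak{m}\in\mathrm{supp}(M)$. Let $S\subseteq\tilde G_\mathfrak{m}$ be a set of representatives of the cosets of $G_\mathfrak{m}$ contained in $\tilde G_\mathfrak{m}$, and let $\zeta:\tilde G_\mathfrak{m}\to S$ be the function defined by requiring $g-\zeta(g)\in G_\mathfrak{m}$. Let $g\in S$, $v\in M_\mathfrak{m}$ and $1\le i\le n$. Then $$X_ia_gv=\begin{cases}a_h\cdot b_{g,i}v & \text{if } g+e_i\in\tilde G_\mathfrak{m},\\ 0&\text{otherwise},\end{cases}$$ where $h=\zeta(g+e_i)$ and $$b_{g,i}=(-h)\big(X_ia_g\,a_{g+e_i-h}'\,a_h'\big)\cdot a_{g+e_i-h},$$ and $$Y_ia_gv=\begin{cases}a_k\cdot c_{g,i}v & \text{if } g-e_i\in\tilde G_\mathfrak{m},\\ 0&\text{otherwise},\end{cases}$$ where $k=\zeta(g-e_i)$ and $$c_{g,i}=(-k)\big(Y_ia_g\,a_{g-e_i-k}'\,a_k'\big)\cdot a_{g-e_i-k}.$$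
   Context: Twisted generalized Weyl constructions and algebras. Let $n\ge 1$, $K$ a field, $R$ a commutative unital $K$-algebra, $\boldsymbol{\sigma}=(\sigma_1,\ldots,\sigma_n)$ pairwise commuting $K$-automorphisms of $R$, $\boldsymbol{\mu}=(\mu_{ij})_{1\le i,j\le n}$ a matrix with entries in $K^*=K\setminus\{0\}$, $\boldsymbol{t}=(t_1,\ldots,t_n)$ nonzero elements of $R$. The twisted generalized Weyl construction (TGWC) $A'$ is the unital $K$-algebra generated over $R$ by $X_i,Y_i$ ($1\le i\le n$) with relations $X_ir=\sigma_i(r)X_i$, $Y_ir=\sigma_i^{-1}(r)Y_i$ ($r\in R$), $Y_iX_i=t_i$, $X_iY_i=\sigma_i(t_i)$, and $X_iY_j=\mu_{ij}Y_jX_i$ for $i\ne j$. It is $\mathbb{Z}^n$-graded by $\deg X_i=e_i$, $\deg Y_i=-e_i$, $\deg r=0$ for $r\in R$ ($e_i$ the standard basis vectors). The twisted generalized Weyl algebra (TGWA) is $A'/I$, where $I$ is the sum of all graded two-sided ideals of $A'$ intersecting $R$ trivially; it inherits the grading. For $A$ either of these, $A=\bigoplus_gA_g$, and $R$ is identified with $A_0$ (so the canonical map $R\to A$ is taken to be injective). Action. $g\in\mathbb{Z}^n$ acts on $R$ by $g(r)=\sigma_1^{g_1}\cdots\sigma_n^{g_n}(r)$ and on the set $\mathrm{Max}(R)$ of maximal ideals by $g(\mathfrak{m})=\{g(r)\mid r\in\mathfrak{m}\}$. $\mathbb{Z}^n_\omega=\{g\in\mathbb{Z}^n\mid g(\mathfrak{m})=\mathfrak{m}\}$,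 where $\omega$ is the orbit of $\mathfrak{m}$. Words. A word is an element $a=Z_1\cdots Z_k$ ($k\ge0$, the empty word being $1$) with each $Z_j\in\{X_i,Y_i\}_i$, together with this representation; $X_i^*=Y_i$, $Y_i^*=X_i$, $a^*=Z_k^*\cdots Z_1^*$; then $a^*a\in R$. Modules. An $A$-module $M$ is a weight module if $M=\bigoplus_{\mathfrak{n}\in\mathrm{Max}(R)}M_\mathfrak{n}$, $M_\mathfrak{n}=\{v\in M\mid \mathfrak{n}v=0\}$; $\mathrm{supp}(M)=\{\mathfrak{n}\mid M_\mathfrak{n}\neq0\}$. A simple weight module $M$ has no proper inner breaks if for any $\mathfrak{n}\in\mathrm{supp}(M)$ and any word $a$ with $aM_\mathfrak{n}\ne0$ we have $a^*a\notin\mathfrak{n}$. Sets and chosen elements. $\tilde G_\mathfrak{m}=\{g\in\mathbb{Z}^n\mid a^*a\notin\mathfrak{m}\text{ for some word }a\in A_g\}$ and $G_\mathfrak{m}=\tilde G_\mathfrak{m}\cap\mathbb{Z}^n_\omega$; $G_\mathfrak{m}$ is a subgroup of $\mathbb{Z}^n$ and $\tilde G_\mathfrak{m}$ is a union of cosets of $G_\mathfrak{m}$. For each $g\in\tilde G_\mathfrak{m}$ a word $a_g\in A_g$ with $a_g^*a_g\notin\mathfrak{m}$ is fixed, with $a_0=1$, and an element $r_g\in R$ is chosen such that $a_g':=r_ga_g^*$ satisfies $a_g'a_g-1\in\mathfrak{m}$. The elements $X_ia_ga'_{g+e_i-h}a'_h$ and $Y_ia_ga'_{g-e_i-k}a'_k$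 have degree $0$, hence lie in $R$, so $\mathbb{Z}^n$ acts on them. *)

theory Defs
  imports
    "HOL-Algebra.QuotRing"
    "HOL-Algebra.Module"
    "HOL-Algebra.Generated_Groups"
    "HOL-Library.Poly_Mapping"
    "HOL-Analysis.Finite_Cartesian_Product"
begin

text \<open>
  A type of class \<open>ring_1\<close> as a ring with carrier \<open>UNIV\<close>. The library's copy
  \<open>ring_of_type_algebra\<close> comes with a theory reserving the symbol \<open>X\<close>.
\<close>

definition type_ring :: "'a::ring_1 ring" where
  "type_ring = \<lparr>carrier = UNIV, monoid.mult = (*), one = 1, ring.zero = 0, add = (+)\<rparr>"


section \<open>Data of a twisted generalized Weyl construction\<close>

text \<open>
  The index set \<open>{1, \<dots>, n}\<close> is a finite (hence nonempty) type \<open>'n\<close>, and the group \<open>\<int>\<^sup>n\<close> is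
  \<open>int ^ 'n\<close> with standard basis vectors \<open>axis i 1\<close>. The \<open>K\<close>-algebra structure of \<open>R\<close> is the
  scalar multiplication \<open>scl\<close>.
\<close>

locale tgw_datum = vector_space scl
  for scl :: "'k::field \<Rightarrow> 'r::comm_ring_1 \<Rightarrow> 'r" +
  fixes \<sigma> :: "'n::finite \<Rightarrow> 'r \<Rightarrow> 'r"
    and t :: "'n \<Rightarrow> 'r"
    and \<mu> :: "'n \<Rightarrow> 'n \<Rightarrow> 'k"
  assumes scl_mult_left: "scl c (x * y) = scl c x * y"
    and \<sigma>_iso: "\<sigma> i \<in> ring_iso type_ring type_ring"
    and \<sigma>_scl: "\<sigma> i (scl c x) = scl c (\<sigma> i x)"
    and \<sigma>_commute: "\<sigma> i \<circ> \<sigma> j = \<sigma> j \<circ> \<sigma> i"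
    and t_nonzero: "t i \<noteq> 0"
    and \<mu>_nonzero: "\<mu> i j \<noteq> 0"

definition auto_pow :: "('r \<Rightarrow> 'r) \<Rightarrow> int \<Rightarrow> 'r \<Rightarrow> 'r" where
  "auto_pow f k = (if 0 \<le> k then f ^^ nat k else (the_inv f) ^^ nat (- k))"

text \<open>The \<open>\<sigma> i\<close> commute pairwise, so the order of composition in the fold is immaterial.\<close>

definition Zn_act :: "('n::finite \<Rightarrow> 'r \<Rightarrow> 'r) \<Rightarrow> int ^ 'n \<Rightarrow> 'r \<Rightarrow> 'r" where
  "Zn_act \<sigma> g = Finite_Set.fold (\<lambda>i f. auto_pow (\<sigma> i) (g $ i) \<circ> f) id UNIV"

definition Max_spec :: "'r::comm_ring_1 set set" where
  "Max_spec = {\<nn>. maximalideal \<nn> type_ring}"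

definition Zn_stabilizer :: "('n::finite \<Rightarrow> 'r \<Rightarrow> 'r) \<Rightarrow> 'r set \<Rightarrow> (int ^ 'n) set" where
  "Zn_stabilizer \<sigma> \<mm> = {g. Zn_act \<sigma> g ` \<mm> = \<mm>}"


section \<open>Words\<close>

datatype 'n letter = LX 'n | LY 'n

primrec letter_star :: "'n letter \<Rightarrow> 'n letter" where
  "letter_star (LX i) = LY i"
| "letter_star (LY i) = LX i"

primrec letter_deg :: "'n::finite letter \<Rightarrow> int ^ 'n" where
  "letter_deg (LX i) = axis i 1"
| "letter_deg (LY i) = - axis i 1"

definition word_star :: "'n letter list \<Rightarrow> 'n letter list" where
  "word_star w = rev (map letter_star w)"

definition word_deg :: "'n::finite letter list \<Rightarrow> int ^ 'n" where
  "word_deg w = sum_list (map letter_deg w)"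

primrec letter_val :: "('n \<Rightarrow> 'a) \<Rightarrow> ('n \<Rightarrow> 'a) \<Rightarrow> 'n letter \<Rightarrow> 'a" where
  "letter_val X Y (LX i) = X i"
| "letter_val X Y (LY i) = Y i"

text \<open>The element of \<open>A\<close> represented by a word.\<close>

definition word_val :: "'a ring \<Rightarrow> ('n \<Rightarrow> 'a) \<Rightarrow> ('n \<Rightarrow> 'a) \<Rightarrow> 'n letter list \<Rightarrow> 'a" where
  "word_val A X Y w = foldr (\<lambda>z x. letter_val X Y z \<otimes>\<^bsub>A\<^esub> x) w \<one>\<^bsub>A\<^esub>"

text \<open>
  The component \<open>A\<^sub>g\<close>. The relations \<open>X\<^sub>i r = \<sigma>\<^sub>i(r) X\<^sub>i\<close> and \<open>Y\<^sub>i r = \<sigma>\<^sub>i\<^sup>-\<^sup>1(r) Y\<^sub>i\<close> move coefficients to the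
  left, so the products of generators of total degree \<open>g\<close> are the elements \<open>r w\<close> with \<open>r \<in> R\<close> and \<open>w\<close>
  a word of degree \<open>g\<close>. Scalars from \<open>K\<close> are absorbed in \<open>r\<close>.
\<close>

definition graded_part ::
  "'a ring \<Rightarrow> ('r \<Rightarrow> 'a) \<Rightarrow> ('n::finite \<Rightarrow> 'a) \<Rightarrow> ('n \<Rightarrow> 'a) \<Rightarrow> int ^ 'n \<Rightarrow> 'a set" where
  "graded_part A \<iota> X Y g =
     generate (add_monoid A) {\<iota> r \<otimes>\<^bsub>A\<^esub> word_val A X Y w | r w. word_deg w = g}"


section \<open>The algebra presented by generators and relations\<close>

datatype 'g free_monoid = Free_Monoid "'g list"

instantiation free_monoid :: (type) monoid_add
begin

definition zero_free_monoid :: "'a free_monoid" where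
  "0 = Free_Monoid []"

fun plus_free_monoid :: "'a free_monoid \<Rightarrow> 'a free_monoid \<Rightarrow> 'a free_monoid" where
  "Free_Monoid u + Free_Monoid v = Free_Monoid (u @ v)"

instance
proof
  fix a b c :: "'a free_monoid"
  show "a + b + c = a + (b + c)"
    by (cases a; cases b; cases c) simp
  show "0 + a = a"
    by (cases a) (simp add: zero_free_monoid_def)
  show "a + 0 = a"
    by (cases a) (simp add: zero_free_monoid_def)
qed

end

text \<open>
  The free unital \<open>K\<close>-algebra on the disjoint union of \<open>R\<close> and the letters \<open>X\<^sub>i, Y\<^sub>i\<close>: finitely
  supported \<open>K\<close>-valued functions on the free monoid, with the convolution product.
\<close>

type_synonym ('k, 'r, 'n) free_alg = "('r + 'n letter) free_monoid \<Rightarrow>\<^sub>0 'k"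

definition fscal :: "'k::field \<Rightarrow> ('k, 'r, 'n) free_alg" where
  "fscal c = Poly_Mapping.single 0 c"

definition fcoef :: "'r \<Rightarrow> ('k::field, 'r, 'n) free_alg" where
  "fcoef r = Poly_Mapping.single (Free_Monoid [Inl r]) 1"

definition fX :: "'n \<Rightarrow> ('k::field, 'r, 'n) free_alg" where
  "fX i = Poly_Mapping.single (Free_Monoid [Inr (LX i)]) 1"

definition fY :: "'n \<Rightarrow> ('k::field, 'r, 'n) free_alg" where
  "fY i = Poly_Mapping.single (Free_Monoid [Inr (LY i)]) 1"

text \<open>The first four families make \<open>fcoef\<close> a homomorphism of unital \<open>K\<close>-algebras modulo the relations.\<close>

definition tgw_relations ::
  "('k::field \<Rightarrow> 'r::comm_ring_1 \<Rightarrow> 'r) \<Rightarrow> ('n \<Rightarrow> 'r \<Rightarrow> 'r) \<Rightarrow> ('n \<Rightarrow> 'r) \<Rightarrow> ('n \<Rightarrow> 'n \<Rightarrow> 'k) \<Rightarrow>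
    ('k, 'r, 'n) free_alg set" where
  "tgw_relations scl \<sigma> t \<mu> =
     {fcoef (r + s) - (fcoef r + fcoef s) | r s. True} \<union>
     {fcoef (scl c r) - fscal c * fcoef r | c r. True} \<union>
     {fcoef (r * s) - fcoef r * fcoef s | r s. True} \<union>
     {fcoef 1 - 1} \<union>
     {fX i * fcoef r - fcoef (\<sigma> i r) * fX i | i r. True} \<union>
     {fY i * fcoef r - fcoef (the_inv (\<sigma> i) r) * fY i | i r. True} \<union>
     {fY i * fX i - fcoef (t i) | i. True} \<union>
     {fX i * fY i - fcoef (\<sigma> i (t i)) | i. True} \<union>
     {fX i * fY j - fscal (\<mu> i j) * fY j * fX i | i j. i \<noteq> j}"

definition tgwc_ideal ::
  "('k::field \<Rightarrow> 'r::comm_ring_1 \<Rightarrow> 'r) \<Rightarrow> ('n \<Rightarrow> 'r \<Rightarrow> 'r) \<Rightarrow> ('n \<Rightarrow> 'r) \<Rightarrow> ('n \<Rightarrow> 'n \<Rightarrow> 'k) \<Rightarrow>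
    ('k, 'r, 'n) free_alg set" where
  "tgwc_ideal scl \<sigma> t \<mu> = genideal type_ring (tgw_relations scl \<sigma> t \<mu>)"

definition tgwc ::
  "('k::field \<Rightarrow> 'r::comm_ring_1 \<Rightarrow> 'r) \<Rightarrow> ('n \<Rightarrow> 'r \<Rightarrow> 'r) \<Rightarrow> ('n \<Rightarrow> 'r) \<Rightarrow> ('n \<Rightarrow> 'n \<Rightarrow> 'k) \<Rightarrow>
    ('k, 'r, 'n) free_alg set ring" where
  "tgwc scl \<sigma> t \<mu> = type_ring Quot tgwc_ideal scl \<sigma> t \<mu>"

definition tgwc_proj ::
  "('k::field \<Rightarrow> 'r::comm_ring_1 \<Rightarrow> 'r) \<Rightarrow> ('n \<Rightarrow> 'r \<Rightarrow> 'r) \<Rightarrow> ('n \<Rightarrow> 'r) \<Rightarrow> ('n \<Rightarrow> 'n \<Rightarrow> 'k) \<Rightarrow>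
    ('k, 'r, 'n) free_alg \<Rightarrow> ('k, 'r, 'n) free_alg set" where
  "tgwc_proj scl \<sigma> t \<mu> x = tgwc_ideal scl \<sigma> t \<mu> +>\<^bsub>type_ring\<^esub> x"


section \<open>The twisted generalized Weyl algebra\<close>

definition graded_ideal ::
  "'a ring \<Rightarrow> ('r \<Rightarrow> 'a) \<Rightarrow> ('n::finite \<Rightarrow> 'a) \<Rightarrow> ('n \<Rightarrow> 'a) \<Rightarrow> 'a set \<Rightarrow> bool" where
  "graded_ideal A \<iota> X Y J \<longleftrightarrow>
     ideal J A \<and> J = generate (add_monoid A) (\<Union>g. J \<inter> graded_part A \<iota> X Y g)"

definition tgwa_ideal ::
  "('k::field \<Rightarrow> 'r::comm_ring_1 \<Rightarrow> 'r) \<Rightarrow> ('n::finite \<Rightarrow> 'r \<Rightarrow> 'r) \<Rightarrow> ('n \<Rightarrow> 'r) \<Rightarrow> ('n \<Rightarrow> 'n \<Rightarrow> 'k) \<Rightarrow>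
    ('k, 'r, 'n) free_alg set set" where
  "tgwa_ideal scl \<sigma> t \<mu> =
     (let A' = tgwc scl \<sigma> t \<mu>; \<pi> = tgwc_proj scl \<sigma> t \<mu>
      in generate (add_monoid A')
           (\<Union>{J. graded_ideal A' (\<lambda>r. \<pi> (fcoef r)) (\<lambda>i. \<pi> (fX i)) (\<lambda>i. \<pi> (fY i)) J \<and>
                J \<inter> range (\<lambda>r. \<pi> (fcoef r)) = {\<zero>\<^bsub>A'\<^esub>}}))"

definition tgwa ::
  "('k::field \<Rightarrow> 'r::comm_ring_1 \<Rightarrow> 'r) \<Rightarrow> ('n::finite \<Rightarrow> 'r \<Rightarrow> 'r) \<Rightarrow> ('n \<Rightarrow> 'r) \<Rightarrow> ('n \<Rightarrow> 'n \<Rightarrow> 'k) \<Rightarrow>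
    ('k, 'r, 'n) free_alg set set ring" where
  "tgwa scl \<sigma> t \<mu> = tgwc scl \<sigma> t \<mu> Quot tgwa_ideal scl \<sigma> t \<mu>"

definition tgwa_proj ::
  "('k::field \<Rightarrow> 'r::comm_ring_1 \<Rightarrow> 'r) \<Rightarrow> ('n::finite \<Rightarrow> 'r \<Rightarrow> 'r) \<Rightarrow> ('n \<Rightarrow> 'r) \<Rightarrow> ('n \<Rightarrow> 'n \<Rightarrow> 'k) \<Rightarrow>
    ('k, 'r, 'n) free_alg \<Rightarrow> ('k, 'r, 'n) free_alg set set" where
  "tgwa_proj scl \<sigma> t \<mu> x =
     tgwa_ideal scl \<sigma> t \<mu> +>\<^bsub>tgwc scl \<sigma> t \<mu>\<^esub> tgwc_proj scl \<sigma> t \<mu> x"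

text \<open>
  The two constructions live on different types. To speak about either of them, a ring \<open>A\<close> with a map
  \<open>\<iota> : R \<rightarrow> A\<close> and elements \<open>X\<^sub>i, Y\<^sub>i\<close> is called a TGWC (TGWA) if it is identified with the quotient above
  by a ring isomorphism matching \<open>\<iota>\<close>, \<open>X\<^sub>i\<close> and \<open>Y\<^sub>i\<close>; such an isomorphism is \<open>K\<close>-linear because \<open>K\<close> acts
  on \<open>A\<close> through \<open>\<iota>\<close>.
\<close>

definition is_TGWC ::
  "('k::field \<Rightarrow> 'r::comm_ring_1 \<Rightarrow> 'r) \<Rightarrow> ('n \<Rightarrow> 'r \<Rightarrow> 'r) \<Rightarrow> ('n \<Rightarrow> 'r) \<Rightarrow> ('n \<Rightarrow> 'n \<Rightarrow> 'k) \<Rightarrow>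
    'a ring \<Rightarrow> ('r \<Rightarrow> 'a) \<Rightarrow> ('n \<Rightarrow> 'a) \<Rightarrow> ('n \<Rightarrow> 'a) \<Rightarrow> bool" where
  "is_TGWC scl \<sigma> t \<mu> A \<iota> X Y \<longleftrightarrow>
     ring A \<and>
     (\<exists>\<phi> \<in> ring_iso (tgwc scl \<sigma> t \<mu>) A.
        (\<forall>r. \<phi> (tgwc_proj scl \<sigma> t \<mu> (fcoef r)) = \<iota> r) \<and>
        (\<forall>i. \<phi> (tgwc_proj scl \<sigma> t \<mu> (fX i)) = X i) \<and>
        (\<forall>i. \<phi> (tgwc_proj scl \<sigma> t \<mu> (fY i)) = Y i))"

definition is_TGWA ::
  "('k::field \<Rightarrow> 'r::comm_ring_1 \<Rightarrow> 'r) \<Rightarrow> ('n::finite \<Rightarrow> 'r \<Rightarrow> 'r) \<Rightarrow> ('n \<Rightarrow> 'r) \<Rightarrow> ('n \<Rightarrow> 'n \<Rightarrow> 'k) \<Rightarrow>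
    'a ring \<Rightarrow> ('r \<Rightarrow> 'a) \<Rightarrow> ('n \<Rightarrow> 'a) \<Rightarrow> ('n \<Rightarrow> 'a) \<Rightarrow> bool" where
  "is_TGWA scl \<sigma> t \<mu> A \<iota> X Y \<longleftrightarrow>
     ring A \<and>
     (\<exists>\<phi> \<in> ring_iso (tgwa scl \<sigma> t \<mu>) A.
        (\<forall>r. \<phi> (tgwa_proj scl \<sigma> t \<mu> (fcoef r)) = \<iota> r) \<and>
        (\<forall>i. \<phi> (tgwa_proj scl \<sigma> t \<mu> (fX i)) = X i) \<and>
        (\<forall>i. \<phi> (tgwa_proj scl \<sigma> t \<mu> (fY i)) = Y i))"

text \<open>
  The action of \<open>\<int>\<^sup>n\<close> on elements of degree \<open>0\<close> of \<open>A\<close>, identified with elements of \<open>R\<close>. It is meaningful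
  only for \<open>\<iota>\<close> injective and \<open>x\<close> in the range of \<open>\<iota>\<close>.
\<close>

definition deg0_act ::
  "('n::finite \<Rightarrow> 'r \<Rightarrow> 'r) \<Rightarrow> ('r \<Rightarrow> 'a) \<Rightarrow> int ^ 'n \<Rightarrow> 'a \<Rightarrow> 'a" where
  "deg0_act \<sigma> \<iota> g x = \<iota> (Zn_act \<sigma> g (the_inv \<iota> x))"


section \<open>Weight modules\<close>

text \<open>The library's locale of modules requires a commutative ring of scalars.\<close>

locale left_module = A?: ring A + M?: abelian_group M
  for A :: "'a ring" and M :: "('a, 'm) module" +
  assumes smult_closed:
      "a \<in> carrier A \<Longrightarrow> v \<in> carrier M \<Longrightarrow> a \<odot>\<^bsub>M\<^esub> v \<in> carrier M"
    and smult_l_distr: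
      "a \<in> carrier A \<Longrightarrow> b \<in> carrier A \<Longrightarrow> v \<in> carrier M \<Longrightarrow>
       (a \<oplus>\<^bsub>A\<^esub> b) \<odot>\<^bsub>M\<^esub> v = a \<odot>\<^bsub>M\<^esub> v \<oplus>\<^bsub>M\<^esub> b \<odot>\<^bsub>M\<^esub> v"
    and smult_r_distr:
      "a \<in> carrier A \<Longrightarrow> v \<in> carrier M \<Longrightarrow> w \<in> carrier M \<Longrightarrow>
       a \<odot>\<^bsub>M\<^esub> (v \<oplus>\<^bsub>M\<^esub> w) = a \<odot>\<^bsub>M\<^esub> v \<oplus>\<^bsub>M\<^esub> a \<odot>\<^bsub>M\<^esub> w"
    and smult_assoc:
      "a \<in> carrier A \<Longrightarrow> b \<in> carrier A \<Longrightarrow> v \<in> carrier M \<Longrightarrow>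
       (a \<otimes>\<^bsub>A\<^esub> b) \<odot>\<^bsub>M\<^esub> v = a \<odot>\<^bsub>M\<^esub> (b \<odot>\<^bsub>M\<^esub> v)"
    and smult_one:
      "v \<in> carrier M \<Longrightarrow> \<one>\<^bsub>A\<^esub> \<odot>\<^bsub>M\<^esub> v = v"

definition simple_module :: "'a ring \<Rightarrow> ('a, 'm) module \<Rightarrow> bool" where
  "simple_module A M \<longleftrightarrow>
     left_module A M \<and> carrier M \<noteq> {\<zero>\<^bsub>M\<^esub>} \<and>
     (\<forall>N. submodule N A M \<longrightarrow> N = {\<zero>\<^bsub>M\<^esub>} \<or> N = carrier M)"

definition weight_space :: "('r \<Rightarrow> 'a) \<Rightarrow> ('a, 'm) module \<Rightarrow> 'r set \<Rightarrow> 'm set" where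
  "weight_space \<iota> M \<nn> = {v \<in> carrier M. \<forall>r\<in>\<nn>. \<iota> r \<odot>\<^bsub>M\<^esub> v = \<zero>\<^bsub>M\<^esub>}"

definition weight_supp :: "('r::comm_ring_1 \<Rightarrow> 'a) \<Rightarrow> ('a, 'm) module \<Rightarrow> 'r set set" where
  "weight_supp \<iota> M = {\<nn> \<in> Max_spec. weight_space \<iota> M \<nn> \<noteq> {\<zero>\<^bsub>M\<^esub>}}"

text \<open>\<open>M\<close> is the internal direct sum of its weight spaces.\<close>

definition weight_module :: "'a ring \<Rightarrow> ('r::comm_ring_1 \<Rightarrow> 'a) \<Rightarrow> ('a, 'm) module \<Rightarrow> bool" where
  "weight_module A \<iota> M \<longleftrightarrow>
     left_module A M \<and>
     (\<forall>v \<in> carrier M. \<exists>F f. finite F \<and> F \<subseteq> Max_spec \<and>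
        (\<forall>\<nn>\<in>F. f \<nn> \<in> weight_space \<iota> M \<nn>) \<and> v = finsum M f F) \<and>
     (\<forall>F f. finite F \<and> F \<subseteq> Max_spec \<and> (\<forall>\<nn>\<in>F. f \<nn> \<in> weight_space \<iota> M \<nn>) \<and>
        finsum M f F = \<zero>\<^bsub>M\<^esub> \<longrightarrow> (\<forall>\<nn>\<in>F. f \<nn> = \<zero>\<^bsub>M\<^esub>))"

definition no_proper_inner_breaks ::
  "'a ring \<Rightarrow> ('r::comm_ring_1 \<Rightarrow> 'a) \<Rightarrow> ('n \<Rightarrow> 'a) \<Rightarrow> ('n \<Rightarrow> 'a) \<Rightarrow> ('a, 'm) module \<Rightarrow> bool" where
  "no_proper_inner_breaks A \<iota> X Y M \<longleftrightarrow>
     (\<forall>\<nn> \<in> weight_supp \<iota> M. \<forall>w.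
        (\<exists>v \<in> weight_space \<iota> M \<nn>. word_val A X Y w \<odot>\<^bsub>M\<^esub> v \<noteq> \<zero>\<^bsub>M\<^esub>) \<longrightarrow>
        word_val A X Y (word_star w) \<otimes>\<^bsub>A\<^esub> word_val A X Y w \<notin> \<iota> ` \<nn>)"

definition G_tilde ::
  "'a ring \<Rightarrow> ('r \<Rightarrow> 'a) \<Rightarrow> ('n::finite \<Rightarrow> 'a) \<Rightarrow> ('n \<Rightarrow> 'a) \<Rightarrow> 'r set \<Rightarrow> (int ^ 'n) set" where
  "G_tilde A \<iota> X Y \<mm> =
     {g. \<exists>w. word_val A X Y w \<in> graded_part A \<iota> X Y g \<and>
             word_val A X Y (word_star w) \<otimes>\<^bsub>A\<^esub> word_val A X Y w \<notin> \<iota> ` \<mm>}"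

end

theory Submission
  imports Defs
begin

text \<open>
  Let \<open>z\<close> be one of the letters \<open>X\<^sub>i, Y\<^sub>i\<close>, of degree \<open>\<plusminus>e\<^sub>i\<close>, and let \<open>p = z a\<^sub>g\<close>, a word of degree
  \<open>g + deg z\<close>. If \<open>p v \<noteq> 0\<close>, then the absence of proper inner breaks gives \<open>p\<^sup>*p \<notin> \<mm>\<close>, so
  \<open>g + deg z\<close> lies in \<open>G_tilde\<close> at \<open>\<mm>\<close>; this settles the second case of both formulas. In the first case put
  \<open>h = \<zeta>(g + deg z)\<close> and \<open>d = g + deg z - h \<in> G\<^sub>\<mm>\<close>. The element \<open>x = p a'\<^sub>d a'\<^sub>h\<close> has degree \<open>0\<close>, hence lies
  in \<open>R\<close>, and \<open>a\<^sub>h (-h)(x) = x a\<^sub>h\<close>. Therefore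
  \<open>a\<^sub>h (-h)(x) a\<^sub>d v = p a'\<^sub>d a'\<^sub>h a\<^sub>h a\<^sub>d v\<close>. As \<open>d\<close> stabilizes \<open>\<mm>\<close>, the vector \<open>a\<^sub>d v\<close> has weight \<open>\<mm>\<close>, and
  \<open>a'\<^sub>h a\<^sub>h\<close>, \<open>a'\<^sub>d a\<^sub>d\<close>, both congruent to \<open>1\<close> modulo \<open>\<mm>\<close>, can be dropped one after the other; \<open>p v\<close>
  remains. This computation is \<open>letter_val_action\<close>.

  Two facts about the grading are needed. The first is that a product of letters of total degree \<open>0\<close>
  lies in \<open>R\<close> (\<open>val_deg_0\<close>): the relations allow all letters \<open>Y\<close> to be collected on the left, and then
  pairs \<open>Y\<^sub>i\<close>, \<open>X\<^sub>i\<close> to be cancelled. The second is that a word \<open>w\<close> with nonzero value in \<open>A\<^sub>g\<close> has letter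
  degree \<open>g\<close> (\<open>word_deg_unique\<close>); without it nothing would be known about the degree of \<open>a\<^sub>g\<^sup>*\<close>. It
  is a consequence of the directness of the sum of the \<open>A\<^sub>g\<close>, and it is proved on the free algebra: both
  constructions are quotients of the free algebra by an ideal that contains the homogeneous components
  of its elements. For the relation ideal this holds because the relations are homogeneous
  (\<open>hcomp_mem_tgwc_ideal\<close>), and for the preimage of the sum of the graded ideals because each of these
  is generated by homogeneous elements (\<open>hcomp_mem_tgwa_ideal\<close>).
\<close>



section \<open>The action of \<open>\<int>\<^sup>n\<close> on \<open>R\<close>\<close>

lemma auto_pow_0 [simp]: "auto_pow f 0 = id"
  by (simp add: auto_pow_def)

lemma auto_pow_1 [simp]: "auto_pow f 1 = f"
  by (simp add: auto_pow_def)

lemma auto_pow_minus_1 [simp]: "auto_pow f (- 1) = the_inv f"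
  by (simp add: auto_pow_def)

lemma comp_the_inv: "bij f \<Longrightarrow> f \<circ> the_inv f = id"
  by (auto simp: fun_eq_iff bij_def f_the_inv_into_f)

lemma the_inv_comp: "bij f \<Longrightarrow> the_inv f \<circ> f = id"
  by (auto simp: fun_eq_iff bij_def the_inv_f_f)

lemma auto_pow_add_1:
  assumes "bij f"
  shows "auto_pow f (k + 1) = f \<circ> auto_pow f k"
proof (cases "0 \<le> k")
  case True
  then show ?thesis
    by (simp add: auto_pow_def nat_add_distrib)
next
  case False
  then have "nat (- k) = Suc (nat (- (k + 1)))"
    by simp
  then have "f \<circ> auto_pow f k = (f \<circ> the_inv f) \<circ> (the_inv f ^^ nat (- (k + 1)))"
    using False by (simp add: auto_pow_def comp_assoc)
  also have "\<dots> = auto_pow f (k + 1)"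
    using False by (auto simp: comp_the_inv[OF assms] auto_pow_def)
  finally show ?thesis ..
qed

lemma auto_pow_diff_1:
  assumes "bij f"
  shows "auto_pow f (k - 1) = the_inv f \<circ> auto_pow f k"
proof -
  have "auto_pow f k = f \<circ> auto_pow f (k - 1)"
    using auto_pow_add_1[OF assms, of "k - 1"] by simp
  then have "the_inv f \<circ> auto_pow f k = (the_inv f \<circ> f) \<circ> auto_pow f (k - 1)"
    by (simp add: comp_assoc)
  then show ?thesis
    by (simp add: the_inv_comp[OF assms])
qed

lemma auto_pow_add:
  assumes "bij f"
  shows "auto_pow f (k + l) = auto_pow f k \<circ> auto_pow f l"
proof (induction k rule: int_induct[where k = 0])
  case base
  then show ?case by simp
next
  case (step1 k)
  have "auto_pow f (k + 1 + l) = auto_pow f (k + l + 1)"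
    by (simp add: algebra_simps)
  then show ?case
    using step1 by (simp add: auto_pow_add_1[OF assms] comp_assoc)
next
  case (step2 k)
  have "auto_pow f (k - 1 + l) = auto_pow f (k + l - 1)"
    by (simp add: algebra_simps)
  then show ?case
    using step2 by (simp add: auto_pow_diff_1[OF assms] comp_assoc)
qed

lemma auto_pow_comp_commute:
  assumes "bij f" and fu: "f \<circ> u = u \<circ> f"
  shows "auto_pow f k \<circ> u = u \<circ> auto_pow f k"
proof -
  have inv: "the_inv f \<circ> u = u \<circ> the_inv f"
  proof -
    have "the_inv f \<circ> u = the_inv f \<circ> (u \<circ> f) \<circ> the_inv f"
      using comp_the_inv[OF assms(1)] by (simp add: comp_assoc)
    also have "\<dots> = (the_inv f \<circ> f) \<circ> u \<circ> the_inv f"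
      by (simp only: fu[symmetric] comp_assoc)
    finally show ?thesis
      by (simp add: the_inv_comp[OF assms(1)])
  qed
  show ?thesis
  proof (induction k rule: int_induct[where k = 0])
    case base
    then show ?case by simp
  next
    case (step1 k)
    then show ?case
      using fu by (simp add: auto_pow_add_1[OF assms(1)] fun_eq_iff)
  next
    case (step2 k)
    then show ?case
      using inv by (simp add: auto_pow_diff_1[OF assms(1)] fun_eq_iff)
  qed
qed

context tgw_datum
begin

lemma bij_\<sigma>: "bij (\<sigma> i)"
  using ring_iso_memE(5)[OF \<sigma>_iso[of i]] by (simp add: type_ring_def)

lemma auto_pow_\<sigma>_commute:
  "auto_pow (\<sigma> i) k \<circ> auto_pow (\<sigma> j) l = auto_pow (\<sigma> j) l \<circ> auto_pow (\<sigma> i) k"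
  by (intro auto_pow_comp_commute bij_\<sigma> auto_pow_comp_commute[symmetric] \<sigma>_commute)

text \<open>
  \<open>Zn_act\<close> is a fold over all indices; the partial folds over finite sets of indices make
  induction on that set possible.
\<close>

definition act_on :: "'n set \<Rightarrow> int ^ 'n \<Rightarrow> 'r \<Rightarrow> 'r" where
  "act_on I g = Finite_Set.fold (\<lambda>i f. auto_pow (\<sigma> i) (g $ i) \<circ> f) id I"

lemma act_on_empty [simp]: "act_on {} g = id"
  by (simp add: act_on_def)

lemma act_on_insert:
  assumes "i \<notin> I"
  shows "act_on (insert i I) g = auto_pow (\<sigma> i) (g $ i) \<circ> act_on I g"
proof -
  interpret comp_fun_commute "\<lambda>i f. auto_pow (\<sigma> i) (g $ i) \<circ> f"
  proof
    fix i j
    show "(\<lambda>f. auto_pow (\<sigma> j) (g $ j) \<circ> f) \<circ> (\<lambda>f. auto_pow (\<sigma> i) (g $ i) \<circ> f) =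
          (\<lambda>f. auto_pow (\<sigma> i) (g $ i) \<circ> f) \<circ> (\<lambda>f. auto_pow (\<sigma> j) (g $ j) \<circ> f)"
      using auto_pow_\<sigma>_commute[of j "g $ j" i "g $ i"]
      by (intro ext) (simp add: fun_eq_iff)
  qed
  show ?thesis
    using assms by (simp add: act_on_def)
qed

lemma act_on_auto_pow_commute:
  "act_on I g \<circ> auto_pow (\<sigma> i) k = auto_pow (\<sigma> i) k \<circ> act_on I g"
proof (induction I rule: finite_induct[OF finite])
  case 1
  then show ?case by simp
next
  case (2 j I)
  then show ?case
    using auto_pow_\<sigma>_commute[of j "g $ j" i k] by (simp add: act_on_insert fun_eq_iff)
qed

lemma act_on_add: "act_on I (g + h) = act_on I g \<circ> act_on I h"
proof (induction I rule: finite_induct[OF finite])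
  case 1
  then show ?case by simp
next
  case (2 i I)
  then show ?case
    using act_on_auto_pow_commute[of I g i "h $ i"]
    by (simp add: act_on_insert auto_pow_add[OF bij_\<sigma>] fun_eq_iff)
qed

lemma act_on_axis: "act_on I (axis i c) = (if i \<in> I then auto_pow (\<sigma> i) c else id)"
  by (induction I rule: finite_induct[OF finite]) (auto simp: act_on_insert axis_def)

lemma act_on_zero: "act_on I 0 = id"
  by (induction I rule: finite_induct[OF finite]) (auto simp: act_on_insert)

lemma Zn_act_eq: "Zn_act \<sigma> g = act_on UNIV g"
  by (simp add: Zn_act_def act_on_def)

lemma Zn_act_add: "Zn_act \<sigma> (g + h) r = Zn_act \<sigma> g (Zn_act \<sigma> h r)"
  by (simp add: Zn_act_eq act_on_add)

lemma Zn_act_zero: "Zn_act \<sigma> 0 r = r"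
  by (simp add: Zn_act_eq act_on_zero)

lemma Zn_act_axis: "Zn_act \<sigma> (axis i 1) r = \<sigma> i r"
  by (simp add: Zn_act_eq act_on_axis)

lemma Zn_act_minus_axis: "Zn_act \<sigma> (- axis i 1) r = the_inv (\<sigma> i) r"
proof -
  have "- axis i 1 = (axis i (- 1) :: int ^ 'n)"
    by (simp add: vec_eq_iff axis_def)
  then show ?thesis
    by (simp add: Zn_act_eq act_on_axis)
qed

end


section \<open>Words of degree zero\<close>

lemma word_deg_simps [simp]:
  "word_deg [] = 0"
  "word_deg (z # w) = letter_deg z + word_deg w"
  "word_deg (u @ w) = word_deg u + word_deg w"
  by (simp_all add: word_deg_def)

lemma letter_deg_star [simp]: "letter_deg (letter_star z) = - letter_deg z"
  by (cases z) simp_all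

lemma word_deg_star: "word_deg (word_star w) = - word_deg w"
  by (induction w) (simp_all add: word_star_def)

text \<open>
  Rewriting of words by the relations, with the coefficients from \<open>R\<close> dropped. Letters \<open>X\<^sub>i\<close> and \<open>Y\<^sub>j\<close> with
  \<open>i \<noteq> j\<close> can be exchanged in both directions because \<open>\<mu>\<^sub>i\<^sub>j\<close> is invertible; no relation exchanges two
  letters \<open>X\<^sub>i\<close>, \<open>X\<^sub>j\<close> or two letters \<open>Y\<^sub>i\<close>, \<open>Y\<^sub>j\<close>.
\<close>

inductive word_red :: "'n letter list \<Rightarrow> 'n letter list \<Rightarrow> bool" where
  red_refl: "word_red w w"
| red_trans: "word_red u v \<Longrightarrow> word_red v w \<Longrightarrow> word_red u w"
| red_Cons: "word_red u w \<Longrightarrow> word_red (z # u) (z # w)"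
| red_XY: "i \<noteq> j \<Longrightarrow> word_red (LX i # LY j # w) (LY j # LX i # w)"
| red_YX: "i \<noteq> j \<Longrightarrow> word_red (LY j # LX i # w) (LX i # LY j # w)"
| red_cancel: "word_red (z # letter_star z # w) w"

lemma word_red_append: "word_red u w \<Longrightarrow> word_red (p @ u) (p @ w)"
  by (induction p) (auto intro: red_Cons)

lemma word_red_deg: "word_red u w \<Longrightarrow> word_deg u = word_deg w"
  by (induction rule: word_red.induct) (simp_all add: algebra_simps)

lemma red_X_past_Ys:
  "\<exists>ys' xs'. word_red (LX i # map LY ys @ map LX xs) (map LY ys' @ map LX xs')"
proof (induction ys)
  case Nil
  have "word_red (LX i # map LY [] @ map LX xs) (map LY [] @ map LX (i # xs))"
    by (simp add: red_refl)
  then show ?case by blast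
next
  case (Cons j ys)
  show ?case
  proof (cases "i = j")
    case True
    then have "word_red (LX i # map LY (j # ys) @ map LX xs) (map LY ys @ map LX xs)"
      using red_cancel[of "LX i"] by simp
    then show ?thesis by blast
  next
    case False
    obtain ys' xs' where
      "word_red (LX i # map LY ys @ map LX xs) (map LY ys' @ map LX xs')"
      using Cons.IH by blast
    then have "word_red (LY j # LX i # map LY ys @ map LX xs) (map LY (j # ys') @ map LX xs')"
      by (simp add: red_Cons)
    then have "word_red (LX i # map LY (j # ys) @ map LX xs) (map LY (j # ys') @ map LX xs')"
      using red_trans[OF red_XY[OF False]] by simp
    then show ?thesis by blast
  qed
qed

lemma red_Ys_before_Xs: "\<exists>ys xs. word_red w (map LY ys @ map LX xs)"
proof (induction w)
  case Nil
  have "word_red [] (map LY [] @ map LX [])"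
    by (simp add: red_refl)
  then show ?case by blast
next
  case (Cons z w)
  obtain ys xs where w: "word_red w (map LY ys @ map LX xs)"
    using Cons.IH by blast
  show ?case
  proof (cases z)
    case (LX i)
    obtain ys' xs' where "word_red (LX i # map LY ys @ map LX xs) (map LY ys' @ map LX xs')"
      using red_X_past_Ys[of i ys xs] by blast
    then have "word_red (z # w) (map LY ys' @ map LX xs')"
      using red_trans[OF red_Cons[OF w, of z]] LX by simp
    then show ?thesis by blast
  next
    case (LY j)
    then have "word_red (z # w) (map LY (j # ys) @ map LX xs)"
      by (simp add: red_Cons w)
    then show ?thesis by blast
  qed
qed

lemma word_deg_Ys_Xs:
  "word_deg (map LY ys @ map LX xs) $ i = int (count_list xs i) - int (count_list ys i)"
proof -
  have "word_deg (map LX xs) $ i = int (count_list xs i)"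
    by (induction xs) (auto simp: axis_def)
  moreover have "word_deg (map LY ys) $ i = - int (count_list ys i)"
    by (induction ys) (auto simp: axis_def)
  ultimately show ?thesis by simp
qed

lemma red_Y_past_Xs:
  assumes "i \<notin> set us"
  shows "word_red (LY i # map LX us @ w) (map LX us @ LY i # w)"
  using assms
proof (induction us)
  case Nil
  then show ?case by (simp add: red_refl)
next
  case (Cons u us)
  then have "word_red (LX u # LY i # map LX us @ w) (map LX (u # us) @ LY i # w)"
    by (simp add: red_Cons)
  moreover have "word_red (LY i # map LX (u # us) @ w) (LX u # LY i # map LX us @ w)"
    using Cons.prems by (auto intro: red_YX)
  ultimately show ?case
    by (rule red_trans[rotated])
qed

text \<open>
  The last of the \<open>Y\<close>s is moved to the right until it meets the first \<open>X\<close> with the same index.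
\<close>

lemma red_Ys_Xs_deg_0:
  assumes "word_deg (map LY ys @ map LX xs) = 0"
  shows "word_red (map LY ys @ map LX xs) []"
  using assms
proof (induction ys arbitrary: xs rule: rev_induct)
  case Nil
  then have "count_list xs i = 0" for i
    using word_deg_Ys_Xs[of "[]" xs i] by simp
  then have "i \<notin> set xs" for i
    by (simp add: count_list_0_iff)
  then have "xs = []"
    by (cases xs) auto
  then show ?case
    by (simp add: red_refl)
next
  case (snoc i ys)
  have "int (count_list xs i) - int (count_list (ys @ [i]) i) = 0"
    unfolding word_deg_Ys_Xs[symmetric] snoc.prems by simp
  then have "count_list xs i \<noteq> 0"
    by simp
  then have "i \<in> set xs"
    by (simp add: count_list_0_iff)
  from split_list_first[OF this]
  obtain us vs where xs: "xs = us @ i # vs" and us: "i \<notin> set us"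
    by blast
  have "word_red (LY i # map LX us @ LX i # map LX vs) (map LX us @ LY i # LX i # map LX vs)"
    by (rule red_Y_past_Xs[OF us])
  moreover have "word_red (map LX us @ LY i # LX i # map LX vs) (map LX us @ map LX vs)"
    using word_red_append[OF red_cancel[of "LY i"]] by simp
  ultimately have "word_red (LY i # map LX us @ LX i # map LX vs) (map LX us @ map LX vs)"
    by (rule red_trans)
  then have red: "word_red (map LY (ys @ [i]) @ map LX xs) (map LY ys @ map LX (us @ vs))"
    using word_red_append[of _ _ "map LY ys"] by (simp add: xs)
  then have "word_deg (map LY ys @ map LX (us @ vs)) = 0"
    using word_red_deg[OF red] snoc.prems by simp
  from red_trans[OF red snoc.IH[OF this]] show ?case .
qed

lemma word_red_deg_0: "word_deg w = 0 \<Longrightarrow> word_red w []"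
proof -
  assume w: "word_deg w = 0"
  obtain ys xs where red: "word_red w (map LY ys @ map LX xs)"
    using red_Ys_before_Xs[of w] by blast
  then have "word_deg (map LY ys @ map LX xs) = 0"
    using word_red_deg[OF red] w by simp
  from red_trans[OF red red_Ys_Xs_deg_0[OF this]] show ?thesis .
qed


section \<open>Homogeneous components in the free algebra\<close>

lemma ring_type_ring [simp]: "ring (type_ring :: 'b::ring_1 ring)"
proof (rule ringI)
  show "abelian_group (type_ring :: 'b ring)"
  proof (rule abelian_groupI)
    fix x :: 'b
    show "\<exists>y\<in>carrier type_ring. y \<oplus>\<^bsub>type_ring\<^esub> x = \<zero>\<^bsub>type_ring\<^esub>"
      by (rule bexI[of _ "- x"]) (simp_all add: type_ring_def)
  qed (simp_all add: type_ring_def add_ac)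
  show "Group.monoid (type_ring :: 'b ring)"
    by (rule monoidI) (simp_all add: type_ring_def mult.assoc)
qed (simp_all add: type_ring_def algebra_simps)

lemma type_ring_simps [simp]:
  "carrier type_ring = UNIV" "mult type_ring x y = x * y" "one type_ring = 1"
  "zero type_ring = 0" "add type_ring x y = x + y"
  by (simp_all add: type_ring_def)

lemma a_inv_type_ring [simp]: "a_inv type_ring (x :: 'b::ring_1) = - x"
proof -
  interpret ring "type_ring :: 'b ring" by simp
  show ?thesis
    by (rule minus_equality) simp_all
qed

text \<open>The degree of a monomial of the free algebra; the elements of \<open>R\<close> have degree \<open>0\<close>.\<close>

primrec monom_deg :: "('r + 'n::finite letter) free_monoid \<Rightarrow> int ^ 'n" where
  "monom_deg (Free_Monoid u) = sum_list (map (case_sum (\<lambda>_. 0) letter_deg) u)"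

lemma monom_deg_zero [simp]: "monom_deg 0 = 0"
  by (simp add: zero_free_monoid_def)

lemma monom_deg_add [simp]: "monom_deg (m + m') = monom_deg m + monom_deg m'"
  by (cases m; cases m') simp

text \<open>
  The homogeneous component of degree \<open>g\<close>. An element \<open>f\<close> is homogeneous of degree \<open>g\<close> iff
  \<open>hcomp g f = f\<close>.
\<close>

definition hcomp :: "int ^ 'n \<Rightarrow> ('k::field, 'r, 'n::finite) free_alg \<Rightarrow> ('k, 'r, 'n) free_alg" where
  "hcomp g = Poly_Mapping.mapp (\<lambda>m c. if monom_deg m = g then c else 0)"

lemma lookup_hcomp:
  "Poly_Mapping.lookup (hcomp g x) m = (if monom_deg m = g then Poly_Mapping.lookup x m else 0)"
  by (auto simp: hcomp_def lookup_mapp in_keys_iff when_def)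

lemma hcomp_zero [simp]: "hcomp g 0 = 0"
  by (rule poly_mapping_eqI) (simp add: lookup_hcomp)

lemma hcomp_add: "hcomp g (x + y) = hcomp g x + hcomp g y"
  by (rule poly_mapping_eqI) (simp add: lookup_hcomp lookup_add)

lemma hcomp_uminus: "hcomp g (- x) = - hcomp g x"
  by (rule poly_mapping_eqI) (simp add: lookup_hcomp)

lemma hcomp_diff: "hcomp g (x - y) = hcomp g x - hcomp g y"
  by (rule poly_mapping_eqI) (simp add: lookup_hcomp lookup_minus)

lemma hcomp_single:
  "hcomp g (Poly_Mapping.single m c) = (if monom_deg m = g then Poly_Mapping.single m c else 0)"
  by (rule poly_mapping_eqI) (auto simp: lookup_hcomp lookup_single when_def)

lemma hcomp_one: "hcomp g 1 = (if g = 0 then 1 else 0)"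
  unfolding single_one[symmetric] hcomp_single by auto

lemma hcomp_hcomp: "hcomp g (hcomp h x) = (if g = h then hcomp h x else 0)"
  by (rule poly_mapping_eqI) (auto simp: lookup_hcomp)

lemma free_alg_induct [case_names single add]:
  fixes x :: "('k::field, 'r, 'n) free_alg"
  assumes single: "\<And>m c. P (Poly_Mapping.single m c)"
    and add: "\<And>x y. P x \<Longrightarrow> P y \<Longrightarrow> P (x + y)"
  shows "P x"
proof (induction x rule: update_induct)
  case const
  then show ?case
    using single[of 0 0] by simp
next
  case (update f a b)
  have "Poly_Mapping.update a b f = f + Poly_Mapping.single a b"
    using update by (intro poly_mapping_eqI)
      (auto simp: lookup_update lookup_add lookup_single in_keys_iff when_def)
  then show ?case
    using update add single by simp
qed

lemma hcomp_single_mult: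
  "hcomp g (Poly_Mapping.single m c * x) =
   Poly_Mapping.single m c * hcomp (g - monom_deg m) x"
  by (induction x rule: free_alg_induct)
    (auto simp: mult_single hcomp_single hcomp_add distrib_left algebra_simps)

lemma hcomp_mult_single:
  "hcomp g (x * Poly_Mapping.single m c) =
   hcomp (g - monom_deg m) x * Poly_Mapping.single m c"
  by (induction x rule: free_alg_induct)
    (auto simp: mult_single hcomp_single hcomp_add distrib_right algebra_simps)

lemma tgw_relations_homogeneous:
  assumes "x \<in> tgw_relations scl \<sigma> t \<mu>"
  shows "hcomp g x = x \<or> hcomp g x = 0"
  using assms
  by (auto simp: tgw_relations_def fcoef_def fscal_def fX_def fY_def mult_single
      hcomp_diff hcomp_add hcomp_single hcomp_one zero_free_monoid_def)

lemma tgwc_ideal_ideal: "ideal (tgwc_ideal scl \<sigma> t \<mu>) type_ring"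
  unfolding tgwc_ideal_def by (rule ring.genideal_ideal) simp_all

lemma tgw_relations_subset: "tgw_relations scl \<sigma> t \<mu> \<subseteq> tgwc_ideal scl \<sigma> t \<mu>"
  unfolding tgwc_ideal_def by (rule ring.genideal_self) simp_all

text \<open>
  The elements all of whose components lie in the relation ideal form an ideal, which contains the
  relations.
\<close>

lemma hcomp_mem_tgwc_ideal:
  fixes scl :: "'k::field \<Rightarrow> 'r::comm_ring_1 \<Rightarrow> 'r" and \<sigma> :: "'n::finite \<Rightarrow> 'r \<Rightarrow> 'r"
  assumes "x \<in> tgwc_ideal scl \<sigma> t \<mu>"
  shows "hcomp g x \<in> tgwc_ideal scl \<sigma> t \<mu>"
proof -
  let ?I = "tgwc_ideal scl \<sigma> t \<mu>"
  let ?H = "{x. \<forall>g. hcomp g x \<in> ?I}"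
  interpret F: ring "type_ring :: ('k, 'r, 'n) free_alg ring" by simp
  interpret I: ideal ?I type_ring by (rule tgwc_ideal_ideal)
  have add: "x + y \<in> ?I" if "x \<in> ?I" "y \<in> ?I" for x y
    using additive_subgroup.a_closed[OF I.additive_subgroup_axioms that] by simp
  have zero: "0 \<in> ?I"
    using additive_subgroup.zero_closed[OF I.additive_subgroup_axioms] by simp
  have l: "y * x \<in> ?I" if "x \<in> ?I" for x y
    using I.I_l_closed[OF that, of y] by simp
  have r: "x * y \<in> ?I" if "x \<in> ?I" for x y
    using I.I_r_closed[OF that, of y] by simp
  have "ideal ?H type_ring"
  proof (rule idealI)
    show "subgroup ?H (add_monoid type_ring)"
    proof (rule F.add.subgroupI)
      show "?H \<noteq> {}"
        using zero by (auto intro: exI[of _ 0])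
    next
      fix x :: "('k, 'r, 'n) free_alg"
      assume "x \<in> ?H"
      then show "\<ominus>\<^bsub>type_ring\<^esub> x \<in> ?H"
        using l[of _ "- 1"] by (simp add: hcomp_uminus)
    next
      fix x y :: "('k, 'r, 'n) free_alg"
      assume "x \<in> ?H" "y \<in> ?H"
      then show "x \<oplus>\<^bsub>type_ring\<^esub> y \<in> ?H"
        by (simp add: hcomp_add add)
    qed simp
  next
    fix x y :: "('k, 'r, 'n) free_alg"
    assume x: "x \<in> ?H"
    have "hcomp g (y * x) \<in> ?I" for g
    proof (induction y rule: free_alg_induct)
      case (single m c)
      then show ?case
        using x l by (simp add: hcomp_single_mult)
    next
      case (add y z)
      then show ?case
        using \<open>\<And>x y. x \<in> ?I \<Longrightarrow> y \<in> ?I \<Longrightarrow> x + y \<in> ?I\<close> by (simp add: distrib_right hcomp_add)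
    qed
    then show "y \<otimes>\<^bsub>type_ring\<^esub> x \<in> ?H" by simp
    have "hcomp g (x * y) \<in> ?I" for g
    proof (induction y rule: free_alg_induct)
      case (single m c)
      then show ?case
        using x r by (simp add: hcomp_mult_single)
    next
      case (add y z)
      then show ?case
        using \<open>\<And>x y. x \<in> ?I \<Longrightarrow> y \<in> ?I \<Longrightarrow> x + y \<in> ?I\<close> by (simp add: distrib_left hcomp_add)
    qed
    then show "x \<otimes>\<^bsub>type_ring\<^esub> y \<in> ?H" by simp
  qed simp
  moreover have "tgw_relations scl \<sigma> t \<mu> \<subseteq> ?H"
  proof (intro subsetI CollectI allI)
    fix x g
    assume x: "x \<in> tgw_relations scl \<sigma> t \<mu>"
    from tgw_relations_homogeneous[OF x, of g] show "hcomp g x \<in> ?I"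
      using subsetD[OF tgw_relations_subset x] zero by auto
  qed
  ultimately have "?I \<subseteq> ?H"
    unfolding tgwc_ideal_def[of scl] by (intro F.genideal_minimal) (simp_all add: tgwc_ideal_def)
  with assms show ?thesis by blast
qed


section \<open>Graded quotients of the free algebra\<close>

text \<open>
  A ring \<open>A\<close> with a homomorphism \<open>\<Phi>\<close> from the free algebra that respects the relations and whose
  kernel contains the homogeneous components of its elements. The map \<open>\<iota>\<close> need not be injective, and
  \<open>\<Phi>\<close> need not be surjective. The scalar \<open>c \<in> K\<close> is represented in \<open>A\<close> by \<open>\<iota> (scl c 1)\<close>.
\<close>

locale tgw_presented = tgw_datum scl \<sigma> t \<mu> + A: ring A
  for scl :: "'k::field \<Rightarrow> 'r::comm_ring_1 \<Rightarrow> 'r"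
    and \<sigma> :: "'n::finite \<Rightarrow> 'r \<Rightarrow> 'r"
    and t :: "'n \<Rightarrow> 'r"
    and \<mu> :: "'n \<Rightarrow> 'n \<Rightarrow> 'k"
    and A :: "'a ring" (structure) +
  fixes \<iota> :: "'r \<Rightarrow> 'a"
    and X Y :: "'n \<Rightarrow> 'a"
    and \<Phi> :: "('k, 'r, 'n) free_alg \<Rightarrow> 'a"
  assumes \<Phi>_hom: "\<Phi> \<in> ring_hom type_ring A"
    and \<Phi>_fcoef: "\<Phi> (fcoef r) = \<iota> r"
    and \<Phi>_fX: "\<Phi> (fX i) = X i"
    and \<Phi>_fY: "\<Phi> (fY i) = Y i"
    and \<Phi>_relation: "x \<in> tgw_relations scl \<sigma> t \<mu> \<Longrightarrow> \<Phi> x = \<zero>"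
    and \<Phi>_hcomp: "\<Phi> x = \<zero> \<Longrightarrow> \<Phi> (hcomp g x) = \<zero>"
begin

abbreviation val :: "'n letter list \<Rightarrow> 'a" where
  "val \<equiv> word_val A X Y"

lemma \<Phi>_closed [simp]: "\<Phi> x \<in> carrier A"
  using ring_hom_closed[OF \<Phi>_hom, of x] by simp

lemma \<Phi>_add: "\<Phi> (x + y) = \<Phi> x \<oplus> \<Phi> y"
  using ring_hom_add[OF \<Phi>_hom, of x y] by simp

lemma \<Phi>_mult: "\<Phi> (x * y) = \<Phi> x \<otimes> \<Phi> y"
  using ring_hom_mult[OF \<Phi>_hom, of x y] by simp

lemma \<Phi>_one: "\<Phi> 1 = \<one>"
  using ring_hom_one[OF \<Phi>_hom] by simp

lemma \<Phi>_zero: "\<Phi> 0 = \<zero>"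
proof -
  have "\<Phi> 0 \<oplus> \<Phi> 0 = \<Phi> 0"
    using \<Phi>_add[of 0 0] by simp
  then show ?thesis
    by (simp add: A.add.r_cancel_one)
qed

lemma \<Phi>_uminus: "\<Phi> (- x) = \<ominus> \<Phi> x"
  using \<Phi>_add[of "- x" x] \<Phi>_zero by (intro A.minus_equality[symmetric]) simp_all

lemma \<Phi>_diff: "\<Phi> (x - y) = \<Phi> x \<ominus> \<Phi> y"
  using \<Phi>_add[of x "- y"] by (simp add: \<Phi>_uminus A.minus_eq)

lemma \<Phi>_eq_iff: "\<Phi> x = \<Phi> y \<longleftrightarrow> \<Phi> (x - y) = \<zero>"
proof
  assume "\<Phi> (x - y) = \<zero>"
  then have "\<Phi> x \<oplus> \<ominus> \<Phi> y = \<zero>"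
    by (simp add: \<Phi>_diff A.minus_eq)
  then have "\<ominus> (\<ominus> \<Phi> y) = \<Phi> x"
    by (intro A.minus_equality) simp_all
  then show "\<Phi> x = \<Phi> y" by simp
qed (simp add: \<Phi>_diff A.minus_eq A.r_neg)

lemma \<Phi>_relation_eq: "x - y \<in> tgw_relations scl \<sigma> t \<mu> \<Longrightarrow> \<Phi> x = \<Phi> y"
  by (simp add: \<Phi>_eq_iff \<Phi>_relation)

lemma \<iota>_closed [simp]: "\<iota> r \<in> carrier A"
  using \<Phi>_closed by (metis \<Phi>_fcoef)

lemma X_closed [simp]: "X i \<in> carrier A"
  using \<Phi>_closed by (metis \<Phi>_fX)

lemma Y_closed [simp]: "Y i \<in> carrier A"
  using \<Phi>_closed by (metis \<Phi>_fY)

lemma \<iota>_add: "\<iota> (r + s) = \<iota> r \<oplus> \<iota> s"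
proof -
  have "\<Phi> (fcoef (r + s)) = \<Phi> (fcoef r + fcoef s)"
    by (rule \<Phi>_relation_eq) (auto simp: tgw_relations_def)
  then show ?thesis by (simp add: \<Phi>_add \<Phi>_fcoef)
qed

lemma \<iota>_mult: "\<iota> (r * s) = \<iota> r \<otimes> \<iota> s"
proof -
  have "\<Phi> (fcoef (r * s)) = \<Phi> (fcoef r * fcoef s)"
    by (rule \<Phi>_relation_eq) (auto simp: tgw_relations_def)
  then show ?thesis by (simp add: \<Phi>_mult \<Phi>_fcoef)
qed

lemma \<iota>_one: "\<iota> 1 = \<one>"
proof -
  have "\<Phi> (fcoef 1) = \<Phi> 1"
    by (rule \<Phi>_relation_eq) (auto simp: tgw_relations_def)
  then show ?thesis by (simp add: \<Phi>_one \<Phi>_fcoef)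
qed

lemma \<iota>_zero: "\<iota> 0 = \<zero>"
proof -
  have "\<iota> 0 \<oplus> \<iota> 0 = \<iota> 0"
    using \<iota>_add[of 0 0] by simp
  then show ?thesis
    by (simp add: A.add.r_cancel_one)
qed

lemma \<Phi>_fscal: "\<Phi> (fscal c) = \<iota> (scl c 1)"
proof -
  have "\<Phi> (fcoef (scl c 1)) = \<Phi> (fscal c * fcoef 1)"
    by (rule \<Phi>_relation_eq) (auto simp: tgw_relations_def)
  then show ?thesis by (simp add: \<Phi>_mult \<Phi>_fcoef \<iota>_one)
qed

lemma X_\<iota>: "X i \<otimes> \<iota> r = \<iota> (\<sigma> i r) \<otimes> X i"
proof -
  have "\<Phi> (fX i * fcoef r) = \<Phi> (fcoef (\<sigma> i r) * fX i)"
    by (rule \<Phi>_relation_eq) (auto simp: tgw_relations_def)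
  then show ?thesis by (simp add: \<Phi>_mult \<Phi>_fcoef \<Phi>_fX)
qed

lemma Y_\<iota>: "Y i \<otimes> \<iota> r = \<iota> (the_inv (\<sigma> i) r) \<otimes> Y i"
proof -
  have "\<Phi> (fY i * fcoef r) = \<Phi> (fcoef (the_inv (\<sigma> i) r) * fY i)"
    by (rule \<Phi>_relation_eq) (auto simp: tgw_relations_def)
  then show ?thesis by (simp add: \<Phi>_mult \<Phi>_fcoef \<Phi>_fY)
qed

lemma Y_X: "Y i \<otimes> X i = \<iota> (t i)"
proof -
  have "\<Phi> (fY i * fX i) = \<Phi> (fcoef (t i))"
    by (rule \<Phi>_relation_eq) (auto simp: tgw_relations_def)
  then show ?thesis by (simp add: \<Phi>_mult \<Phi>_fcoef \<Phi>_fX \<Phi>_fY)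
qed

lemma X_Y: "X i \<otimes> Y i = \<iota> (\<sigma> i (t i))"
proof -
  have "\<Phi> (fX i * fY i) = \<Phi> (fcoef (\<sigma> i (t i)))"
    by (rule \<Phi>_relation_eq) (auto simp: tgw_relations_def)
  then show ?thesis by (simp add: \<Phi>_mult \<Phi>_fcoef \<Phi>_fX \<Phi>_fY)
qed

lemma X_Y_swap:
  assumes "i \<noteq> j"
  shows "X i \<otimes> Y j = \<iota> (scl (\<mu> i j) 1) \<otimes> (Y j \<otimes> X i)"
proof -
  have "\<Phi> (fX i * fY j) = \<Phi> (fscal (\<mu> i j) * fY j * fX i)"
    using assms by (intro \<Phi>_relation_eq) (auto simp: tgw_relations_def)
  then show ?thesis by (simp add: \<Phi>_mult \<Phi>_fscal \<Phi>_fX \<Phi>_fY A.m_assoc)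
qed

lemma Y_X_swap:
  assumes "i \<noteq> j"
  shows "Y j \<otimes> X i = \<iota> (scl (inverse (\<mu> i j)) 1) \<otimes> (X i \<otimes> Y j)"
proof -
  have "scl (inverse (\<mu> i j)) 1 * scl (\<mu> i j) 1 = 1"
    using \<mu>_nonzero[of i j] by (simp flip: scl_mult_left)
  then have "\<iota> (scl (inverse (\<mu> i j)) 1) \<otimes> \<iota> (scl (\<mu> i j) 1) = \<one>"
    by (simp add: \<iota>_one flip: \<iota>_mult)
  then show ?thesis
    by (simp add: X_Y_swap[OF assms] flip: A.m_assoc)
qed


subsection \<open>Words\<close>

lemma letter_val_closed [simp]: "letter_val X Y z \<in> carrier A"
  by (cases z) simp_all

lemma val_closed [simp]: "val w \<in> carrier A"
  by (induction w) (simp_all add: word_val_def)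

lemma val_Nil [simp]: "val [] = \<one>"
  by (simp add: word_val_def)

lemma val_Cons: "val (z # w) = letter_val X Y z \<otimes> val w"
  by (simp add: word_val_def)

lemma val_append: "val (u @ w) = val u \<otimes> val w"
  by (induction u) (simp_all add: val_Cons A.m_assoc)

lemma letter_val_\<iota>: "letter_val X Y z \<otimes> \<iota> r = \<iota> (Zn_act \<sigma> (letter_deg z) r) \<otimes> letter_val X Y z"
  by (cases z) (simp_all add: X_\<iota> Y_\<iota> Zn_act_axis Zn_act_minus_axis)

lemma val_\<iota>: "val w \<otimes> \<iota> r = \<iota> (Zn_act \<sigma> (word_deg w) r) \<otimes> val w"
proof (induction w)
  case Nil
  then show ?case by (simp add: Zn_act_zero)
next
  case (Cons z w)
  have "val (z # w) \<otimes> \<iota> r = letter_val X Y z \<otimes> \<iota> (Zn_act \<sigma> (word_deg w) r) \<otimes> val w"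
    by (simp add: val_Cons A.m_assoc Cons.IH)
  also have "\<dots> = \<iota> (Zn_act \<sigma> (word_deg (z # w)) r) \<otimes> val (z # w)"
    by (simp add: letter_val_\<iota> Zn_act_add val_Cons A.m_assoc)
  finally show ?case .
qed

lemma val_word_red:
  assumes "word_red u w"
  shows "\<exists>r. val u = \<iota> r \<otimes> val w"
  using assms
proof induction
  case (red_refl w)
  have "val w = \<iota> 1 \<otimes> val w"
    by (simp add: \<iota>_one)
  then show ?case by blast
next
  case (red_trans u v w)
  then obtain r s where "val u = \<iota> r \<otimes> val v" "val v = \<iota> s \<otimes> val w"
    by blast
  then have "val u = \<iota> (r * s) \<otimes> val w"
    by (simp add: \<iota>_mult A.m_assoc)
  then show ?case by blast
next
  case (red_Cons u w z)
  then obtain r where "val u = \<iota> r \<otimes> val w"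
    by blast
  then have "val (z # u) = letter_val X Y z \<otimes> \<iota> r \<otimes> val w"
    by (simp add: val_Cons A.m_assoc)
  then have "val (z # u) = \<iota> (Zn_act \<sigma> (letter_deg z) r) \<otimes> val (z # w)"
    by (simp add: val_Cons letter_val_\<iota> A.m_assoc)
  then show ?case by blast
next
  case (red_XY i j w)
  have "val (LX i # LY j # w) = (X i \<otimes> Y j) \<otimes> val w"
    by (simp add: val_Cons A.m_assoc)
  then have "val (LX i # LY j # w) = \<iota> (scl (\<mu> i j) 1) \<otimes> val (LY j # LX i # w)"
    by (simp add: X_Y_swap[OF red_XY] val_Cons A.m_assoc)
  then show ?case by blast
next
  case (red_YX i j w)
  have "val (LY j # LX i # w) = (Y j \<otimes> X i) \<otimes> val w"
    by (simp add: val_Cons A.m_assoc)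
  then have "val (LY j # LX i # w) = \<iota> (scl (inverse (\<mu> i j)) 1) \<otimes> val (LX i # LY j # w)"
    by (simp add: Y_X_swap[OF red_YX] val_Cons A.m_assoc)
  then show ?case by blast
next
  case (red_cancel z w)
  have "\<exists>r. letter_val X Y z \<otimes> letter_val X Y (letter_star z) = \<iota> r"
    by (cases z) (auto simp: X_Y Y_X)
  then show ?case
    by (auto simp: val_Cons simp flip: A.m_assoc)
qed

lemma val_deg_0:
  assumes "word_deg w = 0"
  shows "\<exists>r. val w = \<iota> r"
  using val_word_red[OF word_red_deg_0[OF assms]] by simp


subsection \<open>The grading\<close>

lemma \<Phi>_word: "\<Phi> (Poly_Mapping.single (Free_Monoid (map Inr w)) 1) = val w"
proof (induction w)
  case Nil
  then show ?case
    using \<Phi>_one by (simp flip: zero_free_monoid_def)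
next
  case (Cons z w)
  have "(Poly_Mapping.single (Free_Monoid (map Inr (z # w))) 1 :: ('k, 'r, 'n) free_alg) =
        Poly_Mapping.single (Free_Monoid [Inr z]) 1 *
        Poly_Mapping.single (Free_Monoid (map Inr w)) 1"
    by (simp add: mult_single)
  moreover have "\<Phi> (Poly_Mapping.single (Free_Monoid [Inr z]) 1) = letter_val X Y z"
    using \<Phi>_fX \<Phi>_fY by (cases z) (simp_all add: fX_def fY_def)
  ultimately show ?case
    using Cons.IH by (simp add: \<Phi>_mult val_Cons)
qed

text \<open>The elements of \<open>A\<^sub>g\<close> have homogeneous representatives of degree \<open>g\<close> in the free algebra.\<close>

lemma graded_part_subset: "graded_part A \<iota> X Y g \<subseteq> {\<Phi> f | f. hcomp g f = f}"
  unfolding graded_part_def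
proof (rule A.add.generate_subgroup_incl)
  show "{\<iota> r \<otimes> val w |r w. word_deg w = g} \<subseteq> {\<Phi> f |f. hcomp g f = f}"
  proof clarify
    fix r :: 'r and w :: "'n letter list"
    let ?m = "Free_Monoid (Inl r # map Inr w)"
    have "fcoef r * Poly_Mapping.single (Free_Monoid (map Inr w)) 1 =
          (Poly_Mapping.single ?m 1 :: ('k, 'r, 'n) free_alg)"
      by (simp add: fcoef_def mult_single)
    then have "\<iota> r \<otimes> val w = \<Phi> (Poly_Mapping.single ?m 1)"
      by (simp flip: \<Phi>_mult \<Phi>_word \<Phi>_fcoef)
    moreover have "hcomp (word_deg w) (Poly_Mapping.single ?m 1) =
        (Poly_Mapping.single ?m 1 :: ('k, 'r, 'n) free_alg)"
      by (simp add: hcomp_single word_deg_def comp_def)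
    ultimately show "\<exists>f. \<iota> r \<otimes> val w = \<Phi> f \<and> hcomp (word_deg w) f = f"
      by blast
  qed
  show "subgroup {\<Phi> f |f. hcomp g f = f} (add_monoid A)"
  proof (rule A.add.subgroupI)
    have "\<Phi> 0 \<in> {\<Phi> f |f. hcomp g f = f}"
      by (rule CollectI) (metis hcomp_zero)
    then show "{\<Phi> f |f. hcomp g f = f} \<noteq> {}" by blast
  next
    fix x
    assume "x \<in> {\<Phi> f |f. hcomp g f = f}"
    then obtain f where "x = \<Phi> f" "hcomp g f = f" by blast
    then have "\<ominus> x = \<Phi> (- f) \<and> hcomp g (- f) = - f"
      by (simp add: \<Phi>_uminus hcomp_uminus)
    then show "\<ominus> x \<in> {\<Phi> f |f. hcomp g f = f}" by blast
  next
    fix x y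
    assume "x \<in> {\<Phi> f |f. hcomp g f = f}" "y \<in> {\<Phi> f |f. hcomp g f = f}"
    then obtain f f' where "x = \<Phi> f" "hcomp g f = f" "y = \<Phi> f'" "hcomp g f' = f'" by blast
    then have "x \<oplus> y = \<Phi> (f + f') \<and> hcomp g (f + f') = f + f'"
      by (simp add: \<Phi>_add hcomp_add)
    then show "x \<oplus> y \<in> {\<Phi> f |f. hcomp g f = f}" by blast
  qed auto
qed

lemma val_in_graded_part: "val w \<in> graded_part A \<iota> X Y (word_deg w)"
proof -
  have "\<iota> 1 \<otimes> val w \<in> graded_part A \<iota> X Y (word_deg w)"
    unfolding graded_part_def by (rule generate.incl) blast
  then show ?thesis by (simp add: \<iota>_one)
qed

text \<open>
  The word itself represents its value in the free algebra. If the degrees differed, the component of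
  degree \<open>word_deg w\<close> of the difference of this representative and one of degree \<open>g\<close> would be the word,
  and would lie in the kernel.
\<close>

lemma word_deg_unique:
  assumes "val w \<in> graded_part A \<iota> X Y g" and "val w \<noteq> \<zero>"
  shows "word_deg w = g"
proof (rule ccontr)
  assume ne: "word_deg w \<noteq> g"
  let ?u = "Poly_Mapping.single (Free_Monoid (map Inr w)) 1 :: ('k, 'r, 'n) free_alg"
  have deg: "monom_deg (Free_Monoid (map Inr w) :: ('r + 'n letter) free_monoid) = word_deg w"
    by (simp add: word_deg_def comp_def)
  obtain f where f: "val w = \<Phi> f" "hcomp g f = f"
    using assms(1) graded_part_subset by blast
  then have "\<Phi> (?u - f) = \<zero>"
    using \<Phi>_eq_iff[of ?u f] by (simp add: \<Phi>_word)
  then have "\<Phi> (hcomp (word_deg w) (?u - f)) = \<zero>"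
    by (rule \<Phi>_hcomp)
  moreover have "hcomp (word_deg w) f = 0"
    using f(2) ne hcomp_hcomp[of "word_deg w" g f] by simp
  ultimately have "\<Phi> ?u = \<zero>"
    using deg by (simp add: hcomp_diff hcomp_single)
  with assms(2) show False
    by (simp add: \<Phi>_word)
qed

end


section \<open>The two constructions are graded quotients of the free algebra\<close>

lemma (in ideal) FactRing_eq_zero_iff:
  assumes "x \<in> carrier R"
  shows "I +> x = \<zero>\<^bsub>R Quot I\<^esub> \<longleftrightarrow> x \<in> I"
proof
  assume "I +> x = \<zero>\<^bsub>R Quot I\<^esub>"
  then show "x \<in> I"
    using rcos_const_imp_mem[OF assms] by (simp add: FactRing_def)
next
  assume "x \<in> I"
  then show "I +> x = \<zero>\<^bsub>R Quot I\<^esub>"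
    using a_rcos_zero[OF ideal_axioms] by (simp add: FactRing_def)
qed

lemma tgwc_ring: "ring (tgwc scl \<sigma> t \<mu>)"
  unfolding tgwc_def by (rule ideal.quotient_is_ring[OF tgwc_ideal_ideal])

lemma tgwc_proj_hom: "tgwc_proj scl \<sigma> t \<mu> \<in> ring_hom type_ring (tgwc scl \<sigma> t \<mu>)"
proof -
  have "tgwc_proj scl \<sigma> t \<mu> = (+>\<^bsub>type_ring\<^esub>) (tgwc_ideal scl \<sigma> t \<mu>)"
    by (simp add: tgwc_proj_def fun_eq_iff)
  then show ?thesis
    unfolding tgwc_def using ideal.rcos_ring_hom[OF tgwc_ideal_ideal] by simp
qed

lemma tgwc_proj_eq_zero_iff:
  "tgwc_proj scl \<sigma> t \<mu> x = \<zero>\<^bsub>tgwc scl \<sigma> t \<mu>\<^esub> \<longleftrightarrow> x \<in> tgwc_ideal scl \<sigma> t \<mu>"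
  unfolding tgwc_proj_def tgwc_def
  by (rule ideal.FactRing_eq_zero_iff[OF tgwc_ideal_ideal]) simp

lemma (in tgw_datum) tgwc_presented:
  "tgw_presented scl \<sigma> t \<mu> (tgwc scl \<sigma> t \<mu>) (\<lambda>r. tgwc_proj scl \<sigma> t \<mu> (fcoef r))
     (\<lambda>i. tgwc_proj scl \<sigma> t \<mu> (fX i)) (\<lambda>i. tgwc_proj scl \<sigma> t \<mu> (fY i)) (tgwc_proj scl \<sigma> t \<mu>)"
proof (intro tgw_presented.intro tgw_presented_axioms.intro tgw_datum_axioms tgwc_ring tgwc_proj_hom refl)
  fix x
  assume "x \<in> tgw_relations scl \<sigma> t \<mu>"
  then show "tgwc_proj scl \<sigma> t \<mu> x = \<zero>\<^bsub>tgwc scl \<sigma> t \<mu>\<^esub>"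
    by (simp add: tgwc_proj_eq_zero_iff subsetD[OF tgw_relations_subset])
next
  fix x g
  assume "tgwc_proj scl \<sigma> t \<mu> x = \<zero>\<^bsub>tgwc scl \<sigma> t \<mu>\<^esub>"
  then show "tgwc_proj scl \<sigma> t \<mu> (hcomp g x) = \<zero>\<^bsub>tgwc scl \<sigma> t \<mu>\<^esub>"
    by (simp add: tgwc_proj_eq_zero_iff hcomp_mem_tgwc_ideal)
qed

lemma (in ring) ideal_generate_Union:
  assumes J: "\<And>J. J \<in> \<J> \<Longrightarrow> ideal J R"
  shows "ideal (generate (add_monoid R) (\<Union>\<J>)) R"
proof -
  let ?I = "generate (add_monoid R) (\<Union>\<J>)"
  have carr: "\<Union>\<J> \<subseteq> carrier R"
  proof
    fix x
    assume "x \<in> \<Union>\<J>"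
    then obtain J where "J \<in> \<J>" "x \<in> J" by blast
    then show "x \<in> carrier R"
      using ideal.Icarr[OF J] by simp
  qed
  have I: "subgroup ?I (add_monoid R)"
    by (rule add.generate_is_subgroup[OF carr])
  note add = add.subgroupE(4)[OF I] and neg = add.subgroupE(3)[OF I]
  have zero: "\<zero> \<in> ?I"
    by (rule additive_subgroup.zero_closed[OF additive_subgroupI[OF I]])
  have l: "?I \<subseteq> {x \<in> carrier R. a \<otimes> x \<in> ?I}" if a: "a \<in> carrier R" for a
  proof (rule add.generate_subgroup_incl)
    show "\<Union>\<J> \<subseteq> {x \<in> carrier R. a \<otimes> x \<in> ?I}"
    proof
      fix x
      assume "x \<in> \<Union>\<J>"
      then obtain J where x: "J \<in> \<J>" "x \<in> J" by blast
      then have "a \<otimes> x \<in> \<Union>\<J>"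
        using ideal.I_l_closed[OF J[OF x(1)] x(2) a] by blast
      then show "x \<in> {x \<in> carrier R. a \<otimes> x \<in> ?I}"
        using x carr by (blast intro: generate.incl)
    qed
    show "subgroup {x \<in> carrier R. a \<otimes> x \<in> ?I} (add_monoid R)"
    proof (rule add.subgroupI)
      have "\<zero> \<in> {x \<in> carrier R. a \<otimes> x \<in> ?I}"
        using a zero by simp
      then show "{x \<in> carrier R. a \<otimes> x \<in> ?I} \<noteq> {}" by blast
    next
      fix x
      assume "x \<in> {x \<in> carrier R. a \<otimes> x \<in> ?I}"
      then show "\<ominus> x \<in> {x \<in> carrier R. a \<otimes> x \<in> ?I}"
        using a neg by (simp add: r_minus)
    next
      fix x y
      assume "x \<in> {x \<in> carrier R. a \<otimes> x \<in> ?I}" "y \<in> {x \<in> carrier R. a \<otimes> x \<in> ?I}"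
      then show "x \<oplus> y \<in> {x \<in> carrier R. a \<otimes> x \<in> ?I}"
        using a add by (simp add: r_distr)
    qed simp
  qed
  have r: "?I \<subseteq> {x \<in> carrier R. x \<otimes> a \<in> ?I}" if a: "a \<in> carrier R" for a
  proof (rule add.generate_subgroup_incl)
    show "\<Union>\<J> \<subseteq> {x \<in> carrier R. x \<otimes> a \<in> ?I}"
    proof
      fix x
      assume "x \<in> \<Union>\<J>"
      then obtain J where x: "J \<in> \<J>" "x \<in> J" by blast
      then have "x \<otimes> a \<in> \<Union>\<J>"
        using ideal.I_r_closed[OF J[OF x(1)] x(2) a] by blast
      then show "x \<in> {x \<in> carrier R. x \<otimes> a \<in> ?I}"
        using x carr by (blast intro: generate.incl)
    qed
    show "subgroup {x \<in> carrier R. x \<otimes> a \<in> ?I} (add_monoid R)"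
    proof (rule add.subgroupI)
      have "\<zero> \<in> {x \<in> carrier R. x \<otimes> a \<in> ?I}"
        using a zero by simp
      then show "{x \<in> carrier R. x \<otimes> a \<in> ?I} \<noteq> {}" by blast
    next
      fix x
      assume "x \<in> {x \<in> carrier R. x \<otimes> a \<in> ?I}"
      then show "\<ominus> x \<in> {x \<in> carrier R. x \<otimes> a \<in> ?I}"
        using a neg by (simp add: l_minus)
    next
      fix x y
      assume "x \<in> {x \<in> carrier R. x \<otimes> a \<in> ?I}" "y \<in> {x \<in> carrier R. x \<otimes> a \<in> ?I}"
      then show "x \<oplus> y \<in> {x \<in> carrier R. x \<otimes> a \<in> ?I}"
        using a add by (simp add: l_distr)
    qed simp
  qed
  show ?thesis
  proof (intro idealI ring_axioms I)
    show "a \<otimes> x \<in> ?I" if "x \<in> ?I" "a \<in> carrier R" for x a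
      using subsetD[OF l that(1)] that(2) by simp
    show "x \<otimes> a \<in> ?I" if "x \<in> ?I" "a \<in> carrier R" for x a
      using subsetD[OF r that(1)] that(2) by simp
  qed
qed

text \<open>
  The preimage under \<open>\<Phi>\<close> of a sum of graded ideals contains the homogeneous components of its
  elements. The set \<open>?T\<close> of the values of those \<open>f\<close> whose components all map into the sum is an additive
  group containing the homogeneous elements of each ideal, hence the sum. Which representative \<open>f\<close> of
  an element is taken is immaterial, by \<open>\<Phi>_hcomp\<close>.
\<close>

lemma (in tgw_presented) hcomp_mem_generate_graded_ideals:
  assumes \<J>: "\<And>J. J \<in> \<J> \<Longrightarrow> graded_ideal A \<iota> X Y J"
    and f: "\<Phi> f \<in> generate (add_monoid A) (\<Union>\<J>)"
  shows "\<Phi> (hcomp g f) \<in> generate (add_monoid A) (\<Union>\<J>)"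
proof -
  let ?I = "generate (add_monoid A) (\<Union>\<J>)"
  let ?T = "{\<Phi> f | f. \<forall>g. \<Phi> (hcomp g f) \<in> ?I}"
  have "ideal J A" if "J \<in> \<J>" for J
    using \<J>[OF that] by (simp add: graded_ideal_def)
  then have "ideal ?I A"
    by (rule A.ideal_generate_Union)
  then interpret I: ideal ?I A .
  have add: "x \<oplus> y \<in> ?I" if "x \<in> ?I" "y \<in> ?I" for x y
    using additive_subgroup.a_closed[OF I.additive_subgroup_axioms that] .
  have zero: "\<zero> \<in> ?I"
    using additive_subgroup.zero_closed[OF I.additive_subgroup_axioms] .
  have neg: "\<ominus> x \<in> ?I" if "x \<in> ?I" for x
    using additive_subgroup.a_inv_closed[OF I.additive_subgroup_axioms that] .
  have T: "subgroup ?T (add_monoid A)"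
  proof (rule A.add.subgroupI)
    have "\<Phi> 0 \<in> ?T"
      using zero \<Phi>_zero by (intro CollectI exI[of _ 0]) simp
    then show "?T \<noteq> {}" by blast
  next
    fix x
    assume "x \<in> ?T"
    then obtain f where "x = \<Phi> f" "\<forall>g. \<Phi> (hcomp g f) \<in> ?I" by blast
    then show "\<ominus> x \<in> ?T"
      using neg by (intro CollectI exI[of _ "- f"]) (simp add: \<Phi>_uminus hcomp_uminus)
  next
    fix x y
    assume "x \<in> ?T" "y \<in> ?T"
    then obtain f f' where "x = \<Phi> f" "\<forall>g. \<Phi> (hcomp g f) \<in> ?I"
      "y = \<Phi> f'" "\<forall>g. \<Phi> (hcomp g f') \<in> ?I" by blast
    then show "x \<oplus> y \<in> ?T"
      using add by (intro CollectI exI[of _ "f + f'"]) (simp add: \<Phi>_add hcomp_add)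
  qed auto
  have "J \<subseteq> ?T" if "J \<in> \<J>" for J
  proof -
    have "J \<inter> graded_part A \<iota> X Y h \<subseteq> ?T" for h
    proof
      fix x
      assume x: "x \<in> J \<inter> graded_part A \<iota> X Y h"
      then obtain f where f: "x = \<Phi> f" "hcomp h f = f"
        using graded_part_subset by blast
      have "x \<in> ?I"
        using x that by (blast intro: generate.incl)
      moreover have "hcomp g f = (if g = h then f else 0)" for g
        using hcomp_hcomp[of g h f] f(2) by simp
      ultimately show "x \<in> ?T"
        using f(1) zero \<Phi>_zero by auto
    qed
    then have "generate (add_monoid A) (\<Union>h. J \<inter> graded_part A \<iota> X Y h) \<subseteq> ?T"
      by (intro A.add.generate_subgroup_incl T) blast
    then show ?thesis
      using \<J>[OF that] by (simp add: graded_ideal_def)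
  qed
  then have "?I \<subseteq> ?T"
    by (intro A.add.generate_subgroup_incl T) blast
  with f obtain f' where f': "\<Phi> f = \<Phi> f'" "\<forall>g. \<Phi> (hcomp g f') \<in> ?I"
    by blast
  then have "\<Phi> (hcomp g (f - f')) = \<zero>"
    by (intro \<Phi>_hcomp) (simp flip: \<Phi>_eq_iff)
  then have "\<Phi> (hcomp g f) = \<Phi> (hcomp g f')"
    by (simp add: hcomp_diff \<Phi>_eq_iff)
  with f'(2) show ?thesis by simp
qed

lemma (in tgw_datum) tgwa_ideal_ideal: "ideal (tgwa_ideal scl \<sigma> t \<mu>) (tgwc scl \<sigma> t \<mu>)"
  unfolding tgwa_ideal_def Let_def
  by (rule ring.ideal_generate_Union[OF tgwc_ring]) (auto simp: graded_ideal_def)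

lemma (in tgw_datum) hcomp_mem_tgwa_ideal:
  assumes "tgwc_proj scl \<sigma> t \<mu> x \<in> tgwa_ideal scl \<sigma> t \<mu>"
  shows "tgwc_proj scl \<sigma> t \<mu> (hcomp g x) \<in> tgwa_ideal scl \<sigma> t \<mu>"
  using assms unfolding tgwa_ideal_def Let_def
  by (rule tgw_presented.hcomp_mem_generate_graded_ideals[OF tgwc_presented, rotated]) blast

lemma (in tgw_datum) tgwa_ring: "ring (tgwa scl \<sigma> t \<mu>)"
  unfolding tgwa_def by (rule ideal.quotient_is_ring[OF tgwa_ideal_ideal])

lemma (in tgw_datum) tgwa_proj_hom: "tgwa_proj scl \<sigma> t \<mu> \<in> ring_hom type_ring (tgwa scl \<sigma> t \<mu>)"
proof -
  have "tgwa_proj scl \<sigma> t \<mu> =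
      (+>\<^bsub>tgwc scl \<sigma> t \<mu>\<^esub>) (tgwa_ideal scl \<sigma> t \<mu>) \<circ> tgwc_proj scl \<sigma> t \<mu>"
    by (simp add: tgwa_proj_def fun_eq_iff)
  then show ?thesis
    unfolding tgwa_def
    using ring_hom_trans[OF tgwc_proj_hom ideal.rcos_ring_hom[OF tgwa_ideal_ideal]] by simp
qed

lemma (in tgw_datum) tgwa_proj_eq_zero_iff:
  "tgwa_proj scl \<sigma> t \<mu> x = \<zero>\<^bsub>tgwa scl \<sigma> t \<mu>\<^esub> \<longleftrightarrow>
   tgwc_proj scl \<sigma> t \<mu> x \<in> tgwa_ideal scl \<sigma> t \<mu>"
  unfolding tgwa_proj_def tgwa_def
  by (rule ideal.FactRing_eq_zero_iff[OF tgwa_ideal_ideal])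
    (use ring_hom_closed[OF tgwc_proj_hom] in simp)

lemma (in tgw_datum) tgwa_presented:
  "tgw_presented scl \<sigma> t \<mu> (tgwa scl \<sigma> t \<mu>) (\<lambda>r. tgwa_proj scl \<sigma> t \<mu> (fcoef r))
     (\<lambda>i. tgwa_proj scl \<sigma> t \<mu> (fX i)) (\<lambda>i. tgwa_proj scl \<sigma> t \<mu> (fY i)) (tgwa_proj scl \<sigma> t \<mu>)"
proof (intro tgw_presented.intro tgw_presented_axioms.intro tgw_datum_axioms tgwa_ring tgwa_proj_hom refl)
  fix x
  assume "x \<in> tgw_relations scl \<sigma> t \<mu>"
  then have "tgwc_proj scl \<sigma> t \<mu> x = \<zero>\<^bsub>tgwc scl \<sigma> t \<mu>\<^esub>"
    by (rule tgw_presented.\<Phi>_relation[OF tgwc_presented])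
  then show "tgwa_proj scl \<sigma> t \<mu> x = \<zero>\<^bsub>tgwa scl \<sigma> t \<mu>\<^esub>"
    using additive_subgroup.zero_closed[OF ideal.axioms(1)[OF tgwa_ideal_ideal]]
    by (simp add: tgwa_proj_eq_zero_iff)
next
  fix x g
  assume "tgwa_proj scl \<sigma> t \<mu> x = \<zero>\<^bsub>tgwa scl \<sigma> t \<mu>\<^esub>"
  then show "tgwa_proj scl \<sigma> t \<mu> (hcomp g x) = \<zero>\<^bsub>tgwa scl \<sigma> t \<mu>\<^esub>"
    using hcomp_mem_tgwa_ideal by (simp add: tgwa_proj_eq_zero_iff)
qed

lemma tgw_presented_iso:
  assumes pres: "tgw_presented scl \<sigma> t \<mu> B \<iota> X Y \<Phi>"
    and A: "ring A" and \<phi>: "\<phi> \<in> ring_iso B A"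
  shows "tgw_presented scl \<sigma> t \<mu> A (\<lambda>r. \<phi> (\<iota> r)) (\<lambda>i. \<phi> (X i)) (\<lambda>i. \<phi> (Y i)) (\<lambda>x. \<phi> (\<Phi> x))"
proof -
  interpret B: tgw_presented scl \<sigma> t \<mu> B \<iota> X Y \<Phi> by (rule pres)
  interpret A: ring A by (rule A)
  have hom: "\<phi> \<in> ring_hom B A" and bij: "bij_betw \<phi> (carrier B) (carrier A)"
    using \<phi> by (auto simp: ring_iso_def)
  have zero: "\<phi> \<zero>\<^bsub>B\<^esub> = \<zero>\<^bsub>A\<^esub>"
    using ring_hom_zero[OF hom B.A.ring_axioms A] .
  have iff: "\<phi> (\<Phi> x) = \<zero>\<^bsub>A\<^esub> \<longleftrightarrow> \<Phi> x = \<zero>\<^bsub>B\<^esub>" for x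
    using bij zero by (metis B.\<Phi>_closed B.A.zero_closed bij_betw_def inj_onD)
  show ?thesis
  proof (intro tgw_presented.intro tgw_presented_axioms.intro B.tgw_datum_axioms A)
    show "(\<lambda>x. \<phi> (\<Phi> x)) \<in> ring_hom type_ring A"
      using ring_hom_trans[OF B.\<Phi>_hom hom] by (simp add: comp_def)
  qed (simp_all add: iff zero B.\<Phi>_fcoef B.\<Phi>_fX B.\<Phi>_fY B.\<Phi>_relation B.\<Phi>_hcomp)
qed

lemma (in tgw_datum) is_TGW_presented:
  assumes "is_TGWC scl \<sigma> t \<mu> A \<iota> X Y \<or> is_TGWA scl \<sigma> t \<mu> A \<iota> X Y"
  obtains \<Phi> where "tgw_presented scl \<sigma> t \<mu> A \<iota> X Y \<Phi>"
  using assms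
proof
  assume "is_TGWC scl \<sigma> t \<mu> A \<iota> X Y"
  then obtain \<phi> where A: "ring A" and \<phi>: "\<phi> \<in> ring_iso (tgwc scl \<sigma> t \<mu>) A"
    "\<And>r. \<phi> (tgwc_proj scl \<sigma> t \<mu> (fcoef r)) = \<iota> r"
    "\<And>i. \<phi> (tgwc_proj scl \<sigma> t \<mu> (fX i)) = X i"
    "\<And>i. \<phi> (tgwc_proj scl \<sigma> t \<mu> (fY i)) = Y i"
    unfolding is_TGWC_def by blast
  from tgw_presented_iso[OF tgwc_presented A \<phi>(1)] show thesis
    by (intro that) (simp add: \<phi>(2-))
next
  assume "is_TGWA scl \<sigma> t \<mu> A \<iota> X Y"
  then obtain \<phi> where A: "ring A" and \<phi>: "\<phi> \<in> ring_iso (tgwa scl \<sigma> t \<mu>) A"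
    "\<And>r. \<phi> (tgwa_proj scl \<sigma> t \<mu> (fcoef r)) = \<iota> r"
    "\<And>i. \<phi> (tgwa_proj scl \<sigma> t \<mu> (fX i)) = X i"
    "\<And>i. \<phi> (tgwa_proj scl \<sigma> t \<mu> (fY i)) = Y i"
    unfolding is_TGWA_def by blast
  from tgw_presented_iso[OF tgwa_presented A \<phi>(1)] show thesis
    by (intro that) (simp add: \<phi>(2-))
qed


section \<open>Action of letters on the weight vectors\<close>

text \<open>A left module, not necessarily a weight module, over a ring as in \<open>tgw_presented\<close>.\<close>

locale tgw_module = tgw_presented scl \<sigma> t \<mu> A \<iota> X Y \<Phi> + left_module A M
  for scl :: "'k::field \<Rightarrow> 'r::comm_ring_1 \<Rightarrow> 'r"
    and \<sigma> :: "'n::finite \<Rightarrow> 'r \<Rightarrow> 'r"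
    and t :: "'n \<Rightarrow> 'r"
    and \<mu> :: "'n \<Rightarrow> 'n \<Rightarrow> 'k"
    and A :: "'a ring" (structure)
    and \<iota> :: "'r \<Rightarrow> 'a"
    and X Y :: "'n \<Rightarrow> 'a"
    and \<Phi> :: "('k, 'r, 'n) free_alg \<Rightarrow> 'a"
    and M :: "('a, 'm) module"
begin

lemma smult_zero: "a \<in> carrier A \<Longrightarrow> a \<odot>\<^bsub>M\<^esub> \<zero>\<^bsub>M\<^esub> = \<zero>\<^bsub>M\<^esub>"
  using smult_r_distr[of a "\<zero>\<^bsub>M\<^esub>" "\<zero>\<^bsub>M\<^esub>"] smult_closed[of a "\<zero>\<^bsub>M\<^esub>"]
  by (simp add: M.add.r_cancel_one)

lemma val_weight_space:
  assumes g: "Zn_act \<sigma> (word_deg w) ` \<mm> = \<mm>" and v: "v \<in> weight_space \<iota> M \<mm>"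
  shows "val w \<odot>\<^bsub>M\<^esub> v \<in> weight_space \<iota> M \<mm>"
proof -
  have vM: "v \<in> carrier M"
    using v by (simp add: weight_space_def)
  have "\<iota> r \<odot>\<^bsub>M\<^esub> (val w \<odot>\<^bsub>M\<^esub> v) = \<zero>\<^bsub>M\<^esub>" if r: "r \<in> \<mm>" for r
  proof -
    obtain s where s: "s \<in> \<mm>" "r = Zn_act \<sigma> (word_deg w) s"
      using r g by blast
    have "\<iota> r \<odot>\<^bsub>M\<^esub> (val w \<odot>\<^bsub>M\<^esub> v) = (val w \<otimes> \<iota> s) \<odot>\<^bsub>M\<^esub> v"
      using vM by (simp add: val_\<iota> s(2) smult_assoc)
    also have "\<dots> = val w \<odot>\<^bsub>M\<^esub> (\<iota> s \<odot>\<^bsub>M\<^esub> v)"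
      using vM by (simp add: smult_assoc)
    also have "\<dots> = \<zero>\<^bsub>M\<^esub>"
      using v s(1) by (simp add: weight_space_def smult_zero)
    finally show ?thesis .
  qed
  then show ?thesis
    using vM by (simp add: weight_space_def smult_closed)
qed

lemma smult_eq_self:
  assumes "c \<in> carrier A" "c \<ominus> \<one> \<in> \<iota> ` \<mm>" "v \<in> weight_space \<iota> M \<mm>"
  shows "c \<odot>\<^bsub>M\<^esub> v = v"
proof -
  obtain r where r: "r \<in> \<mm>" "c \<ominus> \<one> = \<iota> r"
    using assms(2) by blast
  have v: "v \<in> carrier M" "\<iota> r \<odot>\<^bsub>M\<^esub> v = \<zero>\<^bsub>M\<^esub>"
    using assms(3) r(1) by (auto simp: weight_space_def)
  have "c = \<iota> r \<oplus> \<one>"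
    using assms(1) by (simp add: r(2)[symmetric] A.minus_eq A.a_assoc A.l_neg)
  then show ?thesis
    using v by (simp add: smult_l_distr smult_one)
qed

text \<open>
  The common content of the two formulas. The letter \<open>z\<close> is \<open>X\<^sub>i\<close> or \<open>Y\<^sub>i\<close>, and \<open>u\<close>, \<open>w\<^sub>h\<close>, \<open>w\<^sub>d\<close> are the words
  \<open>a\<^sub>g\<close>, \<open>a\<^sub>h\<close>, \<open>a\<^sub>d\<close> for \<open>g + deg z = h + d\<close> and \<open>d\<close> in the stabilizer of \<open>\<mm>\<close>; \<open>h'\<close> and \<open>d'\<close> are the elements
  \<open>a'\<^sub>h\<close> and \<open>a'\<^sub>d\<close>.
\<close>

lemma letter_val_action:
  assumes inj: "inj \<iota>"
    and deg: "letter_deg z + word_deg u = word_deg w\<^sub>h + word_deg w\<^sub>d"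
    and stab: "Zn_act \<sigma> (word_deg w\<^sub>d) ` \<mm> = \<mm>"
    and h': "h' = \<iota> r\<^sub>h \<otimes> val (word_star w\<^sub>h)" "h' \<otimes> val w\<^sub>h \<ominus> \<one> \<in> \<iota> ` \<mm>"
    and d': "d' = \<iota> r\<^sub>d \<otimes> val (word_star w\<^sub>d)" "d' \<otimes> val w\<^sub>d \<ominus> \<one> \<in> \<iota> ` \<mm>"
    and v: "v \<in> weight_space \<iota> M \<mm>"
  shows "val w\<^sub>h \<odot>\<^bsub>M\<^esub>
           ((deg0_act \<sigma> \<iota> (- word_deg w\<^sub>h) (letter_val X Y z \<otimes> val u \<otimes> d' \<otimes> h') \<otimes> val w\<^sub>d) \<odot>\<^bsub>M\<^esub> v) =
         (letter_val X Y z \<otimes> val u) \<odot>\<^bsub>M\<^esub> v"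
proof -
  have closed [simp]: "d' \<in> carrier A" "h' \<in> carrier A"
    by (simp_all add: h'(1) d'(1))
  have vM [simp]: "v \<in> carrier M"
    using v by (simp add: weight_space_def)
  define p where "p = letter_val X Y z \<otimes> val u"
  have p [simp]: "p \<in> carrier A" by (simp add: p_def)
  have p_val: "p = val (z # u)"
    by (simp add: p_def val_Cons)
  let ?w = "z # u @ word_star w\<^sub>d @ word_star w\<^sub>h"
  \<comment> \<open>The product has degree \<open>0\<close>; its coefficients are moved to the left of all letters.\<close>
  obtain s where s: "p \<otimes> d' \<otimes> h' = \<iota> s"
  proof -
    have "word_deg ?w = 0"
      using deg by (simp add: word_deg_star algebra_simps)
    then obtain q where q: "val ?w = \<iota> q"
      using val_deg_0 by blast
    define s where "s = Zn_act \<sigma> (word_deg (z # u)) (r\<^sub>d * Zn_act \<sigma> (word_deg (word_star w\<^sub>d)) r\<^sub>h)"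
    have "p \<otimes> d' \<otimes> h' =
        p \<otimes> \<iota> r\<^sub>d \<otimes> (val (word_star w\<^sub>d) \<otimes> \<iota> r\<^sub>h) \<otimes> val (word_star w\<^sub>h)"
      by (simp add: h'(1) d'(1) A.m_assoc)
    also have "\<dots> = (val (z # u) \<otimes> \<iota> (r\<^sub>d * Zn_act \<sigma> (word_deg (word_star w\<^sub>d)) r\<^sub>h)) \<otimes>
        (val (word_star w\<^sub>d) \<otimes> val (word_star w\<^sub>h))"
      unfolding val_\<iota>[of "word_star w\<^sub>d"] by (simp add: \<iota>_mult A.m_assoc p_val)
    also have "\<dots> = \<iota> s \<otimes> val (z # u) \<otimes> (val (word_star w\<^sub>d) \<otimes> val (word_star w\<^sub>h))"
      unfolding val_\<iota> s_def ..
    also have "\<dots> = \<iota> s \<otimes> val ?w"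
      by (simp add: val_append val_Cons A.m_assoc)
    also have "\<dots> = \<iota> (s * q)"
      by (simp add: q \<iota>_mult)
    finally show thesis by (rule that)
  qed
  have act: "val w\<^sub>h \<otimes> deg0_act \<sigma> \<iota> (- word_deg w\<^sub>h) (\<iota> s) = \<iota> s \<otimes> val w\<^sub>h"
    using Zn_act_add[of "word_deg w\<^sub>h" "- word_deg w\<^sub>h" s]
    by (simp add: deg0_act_def the_inv_f_f[OF inj] val_\<iota> Zn_act_zero)
  have b: "deg0_act \<sigma> \<iota> (- word_deg w\<^sub>h) (\<iota> s) \<in> carrier A"
    by (simp add: deg0_act_def)
  have u: "val w\<^sub>d \<odot>\<^bsub>M\<^esub> v \<in> weight_space \<iota> M \<mm>"
    using val_weight_space[OF stab v] .
  have "val w\<^sub>h \<odot>\<^bsub>M\<^esub> ((deg0_act \<sigma> \<iota> (- word_deg w\<^sub>h) (p \<otimes> d' \<otimes> h') \<otimes> val w\<^sub>d) \<odot>\<^bsub>M\<^esub> v) =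
      (val w\<^sub>h \<otimes> deg0_act \<sigma> \<iota> (- word_deg w\<^sub>h) (\<iota> s)) \<odot>\<^bsub>M\<^esub> (val w\<^sub>d \<odot>\<^bsub>M\<^esub> v)"
    using b by (simp add: s smult_assoc smult_closed)
  also have "\<dots> = (p \<otimes> d' \<otimes> h' \<otimes> val w\<^sub>h) \<odot>\<^bsub>M\<^esub> (val w\<^sub>d \<odot>\<^bsub>M\<^esub> v)"
    by (simp only: act s)
  also have "\<dots> = (p \<otimes> d') \<odot>\<^bsub>M\<^esub> ((h' \<otimes> val w\<^sub>h) \<odot>\<^bsub>M\<^esub> (val w\<^sub>d \<odot>\<^bsub>M\<^esub> v))"
    by (simp add: A.m_assoc smult_assoc smult_closed)
  also have "\<dots> = (p \<otimes> d') \<odot>\<^bsub>M\<^esub> (val w\<^sub>d \<odot>\<^bsub>M\<^esub> v)"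
    by (simp add: smult_eq_self[OF _ h'(2) u])
  also have "\<dots> = p \<odot>\<^bsub>M\<^esub> ((d' \<otimes> val w\<^sub>d) \<odot>\<^bsub>M\<^esub> v)"
    by (simp add: smult_assoc smult_closed)
  also have "\<dots> = p \<odot>\<^bsub>M\<^esub> v"
    by (simp add: smult_eq_self[OF _ d'(2) v])
  finally show ?thesis by (simp add: p_def)
qed

end

theorem theorem5p4:
  fixes scl :: "'k::field \<Rightarrow> 'r::comm_ring_1 \<Rightarrow> 'r"
    and \<sigma> :: "'n::finite \<Rightarrow> 'r \<Rightarrow> 'r"
    and t :: "'n \<Rightarrow> 'r"
    and \<mu> :: "'n \<Rightarrow> 'n \<Rightarrow> 'k"
    and A :: "'a ring"
    and \<iota> :: "'r \<Rightarrow> 'a"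
    and X Y :: "'n \<Rightarrow> 'a"
    and M :: "('a, 'm) module"
    and \<mm> :: "'r set"
    and Gt G S :: "(int ^ 'n) set"
    and W :: "'n letter list \<Rightarrow> 'a"
    and a :: "int ^ 'n \<Rightarrow> 'n letter list"
    and \<rho> :: "int ^ 'n \<Rightarrow> 'r"
    and a' :: "int ^ 'n \<Rightarrow> 'a"
    and \<zeta> :: "int ^ 'n \<Rightarrow> int ^ 'n"
    and g :: "int ^ 'n"
    and v :: 'm
    and i :: 'n
  assumes "tgw_datum scl \<sigma> t \<mu>"
    and "is_TGWC scl \<sigma> t \<mu> A \<iota> X Y \<or> is_TGWA scl \<sigma> t \<mu> A \<iota> X Y"
    and "inj \<iota>"
    and "simple_module A M"
    and "weight_module A \<iota> M"
    and "no_proper_inner_breaks A \<iota> X Y M"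
    and "\<mm> \<in> weight_supp \<iota> M"
    and "Gt = G_tilde A \<iota> X Y \<mm>"
    and "G = Gt \<inter> Zn_stabilizer \<sigma> \<mm>"
    and "W = word_val A X Y"
    and "\<And>h. h \<in> Gt \<Longrightarrow> W (a h) \<in> graded_part A \<iota> X Y h"
    and "\<And>h. h \<in> Gt \<Longrightarrow> W (word_star (a h)) \<otimes>\<^bsub>A\<^esub> W (a h) \<notin> \<iota> ` \<mm>"
    and "a 0 = []"
    and "\<And>h. h \<in> Gt \<Longrightarrow> a' h = \<iota> (\<rho> h) \<otimes>\<^bsub>A\<^esub> W (word_star (a h))"
    and "\<And>h. h \<in> Gt \<Longrightarrow> a' h \<otimes>\<^bsub>A\<^esub> W (a h) \<ominus>\<^bsub>A\<^esub> \<one>\<^bsub>A\<^esub> \<in> \<iota> ` \<mm>"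
    and "S \<subseteq> Gt"
    and "\<And>C. C \<in> range (\<lambda>h. (+) h ` G) \<Longrightarrow> C \<subseteq> Gt \<Longrightarrow> \<exists>!s. s \<in> S \<inter> C"
    and "\<And>h. h \<in> Gt \<Longrightarrow> \<zeta> h \<in> S \<and> h - \<zeta> h \<in> G"
    and "g \<in> S"
    and "v \<in> weight_space \<iota> M \<mm>"
  shows "(X i \<otimes>\<^bsub>A\<^esub> W (a g)) \<odot>\<^bsub>M\<^esub> v =
           (if g + axis i 1 \<in> Gt then
              let h = \<zeta> (g + axis i 1);
                  b = deg0_act \<sigma> \<iota> (- h)
                        (X i \<otimes>\<^bsub>A\<^esub> W (a g) \<otimes>\<^bsub>A\<^esub> a' (g + axis i 1 - h) \<otimes>\<^bsub>A\<^esub> a' h)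
                      \<otimes>\<^bsub>A\<^esub> W (a (g + axis i 1 - h))
              in W (a h) \<odot>\<^bsub>M\<^esub> (b \<odot>\<^bsub>M\<^esub> v)
            else \<zero>\<^bsub>M\<^esub>) \<and>
         (Y i \<otimes>\<^bsub>A\<^esub> W (a g)) \<odot>\<^bsub>M\<^esub> v =
           (if g - axis i 1 \<in> Gt then
              let k = \<zeta> (g - axis i 1);
                  c = deg0_act \<sigma> \<iota> (- k)
                        (Y i \<otimes>\<^bsub>A\<^esub> W (a g) \<otimes>\<^bsub>A\<^esub> a' (g - axis i 1 - k) \<otimes>\<^bsub>A\<^esub> a' k)
                      \<otimes>\<^bsub>A\<^esub> W (a (g - axis i 1 - k))
              in W (a k) \<odot>\<^bsub>M\<^esub> (c \<odot>\<^bsub>M\<^esub> v)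
            else \<zero>\<^bsub>M\<^esub>)"
  (is "?X \<and> ?Y")
proof -
  interpret tgw_datum scl \<sigma> t \<mu> by fact
  obtain \<Phi> where pres: "tgw_presented scl \<sigma> t \<mu> A \<iota> X Y \<Phi>"
    using is_TGW_presented[OF assms(2)] by blast
  interpret tgw_module scl \<sigma> t \<mu> A \<iota> X Y \<Phi> M
    using pres assms(4) by (simp add: tgw_module_def simple_module_def)
  note Gt = assms(8) and W = assms(10)
  have \<mm>: "0 \<in> \<mm>"
  proof -
    have "ideal \<mm> type_ring"
      using assms(7) by (simp add: weight_supp_def Max_spec_def maximalideal.axioms(1))
    from additive_subgroup.zero_closed[OF ideal.axioms(1)[OF this]] show ?thesis by simp
  qed
  have deg: "word_deg (a h) = h" if h: "h \<in> Gt" for h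
  proof (rule word_deg_unique)
    show "val (a h) \<in> graded_part A \<iota> X Y h"
      using assms(11)[OF h] by (simp add: W)
    show "val (a h) \<noteq> \<zero>\<^bsub>A\<^esub>"
    proof
      assume "val (a h) = \<zero>\<^bsub>A\<^esub>"
      then have "val (word_star (a h)) \<otimes>\<^bsub>A\<^esub> val (a h) = \<iota> 0"
        by (simp add: \<iota>_zero)
      then show False
        using assms(12)[OF h] \<mm> by (auto simp: W)
    qed
  qed
  have g: "g \<in> Gt"
    using assms(16,19) by blast
  have outside: "(letter_val X Y z \<otimes>\<^bsub>A\<^esub> val (a g)) \<odot>\<^bsub>M\<^esub> v = \<zero>\<^bsub>M\<^esub>"
    if "g + letter_deg z \<notin> Gt" for z
  proof (rule ccontr)
    assume "(letter_val X Y z \<otimes>\<^bsub>A\<^esub> val (a g)) \<odot>\<^bsub>M\<^esub> v \<noteq> \<zero>\<^bsub>M\<^esub>"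
    then have "val (z # a g) \<odot>\<^bsub>M\<^esub> v \<noteq> \<zero>\<^bsub>M\<^esub>"
      by (simp add: val_Cons)
    then have "val (word_star (z # a g)) \<otimes>\<^bsub>A\<^esub> val (z # a g) \<notin> \<iota> ` \<mm>"
      using assms(6,7,20) unfolding no_proper_inner_breaks_def by blast
    moreover have "val (z # a g) \<in> graded_part A \<iota> X Y (g + letter_deg z)"
      using val_in_graded_part[of "z # a g"] deg[OF g] by (simp add: add.commute)
    ultimately show False
      using that unfolding Gt G_tilde_def by blast
  qed
  have inside: "val (a h) \<odot>\<^bsub>M\<^esub>
      ((deg0_act \<sigma> \<iota> (- h)
          (letter_val X Y z \<otimes>\<^bsub>A\<^esub> val (a g) \<otimes>\<^bsub>A\<^esub> a' (g + letter_deg z - h) \<otimes>\<^bsub>A\<^esub> a' h)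
        \<otimes>\<^bsub>A\<^esub> val (a (g + letter_deg z - h))) \<odot>\<^bsub>M\<^esub> v) =
      (letter_val X Y z \<otimes>\<^bsub>A\<^esub> val (a g)) \<odot>\<^bsub>M\<^esub> v"
    if z: "g + letter_deg z \<in> Gt" and h: "h = \<zeta> (g + letter_deg z)" for z h
  proof -
    let ?d = "g + letter_deg z - h"
    have hGt: "h \<in> Gt" and d: "?d \<in> Gt" "?d \<in> Zn_stabilizer \<sigma> \<mm>"
      using assms(18)[OF z] assms(16) by (auto simp: h assms(9))
    have "val (a h) \<odot>\<^bsub>M\<^esub>
      ((deg0_act \<sigma> \<iota> (- word_deg (a h))
          (letter_val X Y z \<otimes>\<^bsub>A\<^esub> val (a g) \<otimes>\<^bsub>A\<^esub> a' ?d \<otimes>\<^bsub>A\<^esub> a' h)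
        \<otimes>\<^bsub>A\<^esub> val (a ?d)) \<odot>\<^bsub>M\<^esub> v) =
      (letter_val X Y z \<otimes>\<^bsub>A\<^esub> val (a g)) \<odot>\<^bsub>M\<^esub> v"
    proof (rule letter_val_action[OF assms(3)])
      show "letter_deg z + word_deg (a g) = word_deg (a h) + word_deg (a ?d)"
        by (simp only: deg g hGt d(1)) (simp add: algebra_simps)
      show "Zn_act \<sigma> (word_deg (a ?d)) ` \<mm> = \<mm>"
        using d(2) unfolding deg[OF d(1)] Zn_stabilizer_def by simp
      show "a' h = \<iota> (\<rho> h) \<otimes>\<^bsub>A\<^esub> val (word_star (a h))"
        using assms(14)[OF hGt] by (simp add: W)
      show "a' h \<otimes>\<^bsub>A\<^esub> val (a h) \<ominus>\<^bsub>A\<^esub> \<one>\<^bsub>A\<^esub> \<in> \<iota> ` \<mm>"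
        using assms(15)[OF hGt] by (simp add: W)
      show "a' ?d = \<iota> (\<rho> ?d) \<otimes>\<^bsub>A\<^esub> val (word_star (a ?d))"
        using assms(14)[OF d(1)] by (simp add: W)
      show "a' ?d \<otimes>\<^bsub>A\<^esub> val (a ?d) \<ominus>\<^bsub>A\<^esub> \<one>\<^bsub>A\<^esub> \<in> \<iota> ` \<mm>"
        using assms(15)[OF d(1)] by (simp add: W)
      show "v \<in> weight_space \<iota> M \<mm>" by fact
    qed
    then show ?thesis
      by (simp only: deg[OF hGt])
  qed
  have ?X
    using inside[of "LX i"] outside[of "LX i"] by (simp add: W Let_def)
  moreover have ?Y
    using inside[of "LY i"] outside[of "LY i"] by (simp add: W Let_def)
  ultimately show ?thesis ..
qed

end
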